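(* Let $G=(V,E)$ be an undirected graph with $n=|V|$ vertices, let $w:[V]^2\to\mathbb{N}$ be a weight function, $c:[V]^2\to\mathbb{N}^*$ a cost function, and $B\ge 0$ an integer. Let $K$ be the complete graph on $V$ (with the same weights and costs), augmented with a self-loop at every vertex of weight $0$ and cost $1$. The All-Pairs $B$-Shortest Paths problem — computing, for every integer $0\le \beta\le B$ and every pair of vertices $u,v\in V$, a minimum-weight $\beta$-bounded-cost path in $K$ connecting $u$ and $v$ (if one exists) — can be solved in $O(Bn^3+Bn^2\log(Bn))$ time using $O(Bn^2)$ space.
   Context: $[V]^2$ denotes the set of all unordered pairs of vertices (all possible edges on $V$); a non-edge of $G$ is an element of $[V]^2\setminus E$, and the self-loops of $K$ are also regarded as not being edges of $G$. The weight of a path is the sum of the weights of its edges. For $0\le\beta\le B$, a path in $K$ is a $\beta$-bounded-cost path if the non-edges of $G$ it uses have total cost at most $\beta$.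
   Formalization: Inside the time and space bounds B is replaced by max(1,B), since for B = 0 the stated bounds are 0 and log(Bn) is undefined; the graph is assumed to have at least one vertex. *)

theory Defs
  imports Complex_Main
begin

section \<open>Bounded-cost paths in the augmented complete graph\<close>

definition pairs :: "'a set \<Rightarrow> 'a set set" where
  "pairs V = {e. e \<subseteq> V \<and> card e = 2}"

text \<open>A self-loop at \<open>v\<close> is the singleton \<open>{v}\<close>, so that \<open>{u, v}\<close> is an edge of \<open>K\<close> for all
  vertices \<open>u\<close> and \<open>v\<close>, equal or not. A set of edges \<open>E \<subseteq> pairs V\<close> never contains a self-loop.\<close>

definition K_edges :: "'a set \<Rightarrow> 'a set set" where
  "K_edges V = pairs V \<union> {{v} | v. v \<in> V}"

definition K_weight :: "('a set \<Rightarrow> nat) \<Rightarrow> 'a set \<Rightarrow> nat" where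
  "K_weight w e = (if card e = 1 then 0 else w e)"

definition K_cost :: "('a set \<Rightarrow> nat) \<Rightarrow> 'a set \<Rightarrow> nat" where
  "K_cost c e = (if card e = 1 then 1 else c e)"

fun path_edges :: "'a list \<Rightarrow> 'a set list" where
  "path_edges (x # y # xs) = {x, y} # path_edges (y # xs)"
| "path_edges _ = []"

text \<open>Paths are lists of vertices. Traversing a self-loop repeats the current vertex;
  apart from that (hence \<^const>\<open>remdups_adj\<close>) a path visits no vertex twice.
  A single vertex is a path without edges.\<close>

definition K_path :: "'a set \<Rightarrow> 'a \<Rightarrow> 'a \<Rightarrow> 'a list \<Rightarrow> bool" where
  "K_path V u v p \<longleftrightarrow> p \<noteq> [] \<and> hd p = u \<and> last p = v \<and> set p \<subseteq> V
     \<and> set (path_edges p) \<subseteq> K_edges V \<and> distinct (remdups_adj p)"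

definition path_weight :: "('a set \<Rightarrow> nat) \<Rightarrow> 'a list \<Rightarrow> nat" where
  "path_weight w p = sum_list (map (K_weight w) (path_edges p))"

definition nonedge_cost :: "'a set set \<Rightarrow> ('a set \<Rightarrow> nat) \<Rightarrow> 'a list \<Rightarrow> nat" where
  "nonedge_cost E c p = sum_list (map (K_cost c) (filter (\<lambda>e. e \<notin> E) (path_edges p)))"

definition bounded_cost_path ::
    "'a set \<Rightarrow> 'a set set \<Rightarrow> ('a set \<Rightarrow> nat) \<Rightarrow> nat \<Rightarrow> 'a \<Rightarrow> 'a \<Rightarrow> 'a list \<Rightarrow> bool" where
  "bounded_cost_path V E c \<beta> u v p \<longleftrightarrow> K_path V u v p \<and> nonedge_cost E c p \<le> \<beta>"

definition min_weight_path ::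
    "'a set \<Rightarrow> 'a set set \<Rightarrow> ('a set \<Rightarrow> nat) \<Rightarrow> ('a set \<Rightarrow> nat) \<Rightarrow> nat \<Rightarrow> 'a \<Rightarrow> 'a \<Rightarrow> 'a list \<Rightarrow> bool" where
  "min_weight_path V E w c \<beta> u v p \<longleftrightarrow>
     is_arg_min (path_weight w) (bounded_cost_path V E c \<beta> u v) p"


section \<open>Input and output of the all-pairs problem\<close>

text \<open>The vertices are \<open>0, \<dots>, n - 1\<close>. An instance is presented as \<open>n\<close> and \<open>B\<close> followed by the
  adjacency matrix of \<open>G\<close> and the weight and cost matrices of \<open>K\<close>, all in row-major order.\<close>

definition matrix :: "nat \<Rightarrow> (nat set \<Rightarrow> nat) \<Rightarrow> nat list" where
  "matrix n f = [f {u, v}. u \<leftarrow> [0..<n], v \<leftarrow> [0..<n]]"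

definition apbsp_input ::
    "nat \<Rightarrow> nat set set \<Rightarrow> (nat set \<Rightarrow> nat) \<Rightarrow> (nat set \<Rightarrow> nat) \<Rightarrow> nat \<Rightarrow> nat list" where
  "apbsp_input n E w c B =
     [n, B] @ matrix n (\<lambda>e. of_bool (e \<in> E)) @ matrix n (K_weight w) @ matrix n (K_cost c)"

text \<open>The output lists the answers for all \<open>\<beta>\<close>, \<open>u\<close>, \<open>v\<close> in lexicographic order. Each answer is
  a path written out vertex by vertex and preceded by its number of vertices, which is \<open>0\<close> if
  there is no path.\<close>

definition apbsp_output ::
    "nat \<Rightarrow> nat set set \<Rightarrow> (nat set \<Rightarrow> nat) \<Rightarrow> (nat set \<Rightarrow> nat) \<Rightarrow> nat \<Rightarrow> nat list \<Rightarrow> bool" where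
  "apbsp_output n E w c B ys \<longleftrightarrow>
     (\<exists>P. (\<forall>\<beta>\<le>B. \<forall>u<n. \<forall>v<n.
             if \<exists>p. bounded_cost_path {..<n} E c \<beta> u v p
             then min_weight_path {..<n} E w c \<beta> u v (P \<beta> u v)
             else P \<beta> u v = [])
        \<and> ys = concat [length (P \<beta> u v) # P \<beta> u v.
                         \<beta> \<leftarrow> [0..<Suc B], u \<leftarrow> [0..<n], v \<leftarrow> [0..<n]])"


section \<open>Word RAM\<close>

text \<open>A program works on registers, a random-access memory of \<open>S\<close> words, and a write-only output
  stream. Every word holds a natural number below \<open>W\<close>. A machine that computes a larger number or
  addresses a memory cell outside \<open>{..<S}\<close> gets stuck. Every instruction takes one unit of time.
  Space is the number \<open>S\<close> of memory words, which include the input; a program only mentions a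
  constant number of registers, and the output is not stored.\<close>

datatype instr =
    Const nat nat
  | Add nat nat nat
  | Sub nat nat nat
  | Mul nat nat nat
  | Load nat nat
  | Store nat nat
  | Jump nat
  | Jump_Less nat nat nat
  | Write nat

record config =
  pc :: nat
  regs :: "nat \<Rightarrow> nat"
  mem :: "nat \<Rightarrow> nat"
  out :: "nat list"

definition next_pc :: "config \<Rightarrow> config" where
  "next_pc s = s\<lparr>pc := Suc (pc s)\<rparr>"

definition set_reg :: "nat \<Rightarrow> nat \<Rightarrow> nat \<Rightarrow> config \<Rightarrow> config option" where
  "set_reg W r x s = (if x < W then Some (next_pc (s\<lparr>regs := (regs s)(r := x)\<rparr>)) else None)"

fun exec_instr :: "nat \<Rightarrow> nat \<Rightarrow> instr \<Rightarrow> config \<Rightarrow> config option" where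
  "exec_instr S W (Const r x) s = set_reg W r x s"
| "exec_instr S W (Add r i j) s = set_reg W r (regs s i + regs s j) s"
| "exec_instr S W (Sub r i j) s = set_reg W r (regs s i - regs s j) s"
| "exec_instr S W (Mul r i j) s = set_reg W r (regs s i * regs s j) s"
| "exec_instr S W (Load r i) s =
     (if regs s i < S then set_reg W r (mem s (regs s i)) s else None)"
| "exec_instr S W (Store i r) s =
     (if regs s i < S then Some (next_pc (s\<lparr>mem := (mem s)(regs s i := regs s r)\<rparr>)) else None)"
| "exec_instr S W (Jump l) s = Some (s\<lparr>pc := l\<rparr>)"
| "exec_instr S W (Jump_Less i j l) s =
     Some (if regs s i < regs s j then s\<lparr>pc := l\<rparr> else next_pc s)"
| "exec_instr S W (Write r) s = Some (next_pc (s\<lparr>out := out s @ [regs s r]\<rparr>))"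

fun exec_steps :: "nat \<Rightarrow> nat \<Rightarrow> instr list \<Rightarrow> nat \<Rightarrow> config \<Rightarrow> config option" where
  "exec_steps S W prog 0 s = Some s"
| "exec_steps S W prog (Suc t) s =
     (if pc s < length prog
      then Option.bind (exec_instr S W (prog ! pc s) s) (exec_steps S W prog t)
      else None)"

definition init_config :: "nat list \<Rightarrow> config" where
  "init_config xs = \<lparr>pc = 0, regs = (\<lambda>_. 0),
     mem = (\<lambda>i. if i < length xs then xs ! i else 0), out = []\<rparr>"

text \<open>On input \<open>xs\<close>, the program halts after exactly \<open>t\<close> steps, by moving the program counter
  past its end, and has then written \<open>ys\<close>.\<close>

definition ram_computes ::
    "nat \<Rightarrow> nat \<Rightarrow> instr list \<Rightarrow> nat list \<Rightarrow> nat \<Rightarrow> nat list \<Rightarrow> bool" where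
  "ram_computes S W prog xs t ys \<longleftrightarrow>
     length xs \<le> S \<and> (\<forall>x\<in>set xs. x < W)
     \<and> (\<exists>s. exec_steps S W prog t (init_config xs) = Some s
            \<and> length prog \<le> pc s \<and> out s = ys)"

text \<open>Words have \<open>O(log m)\<close> bits, where \<open>m\<close> bounds the numbers in the input; among these are
  \<open>n\<close> and \<open>B\<close> for an instance of the all-pairs problem.\<close>

definition word_bound :: "nat \<Rightarrow> nat list \<Rightarrow> nat" where
  "word_bound k xs = (Max (set xs) + 2) ^ k"

end

theory Submission imports Defs begin

text \<open>Replace every weight \<open>w e\<close> by the positive length \<open>n * w e + 1\<close>. A shortest walk for these
  lengths is simple and has least weight, and self-loops only add to length and cost, so they can be
  ignored. For a budget \<open>\<beta>\<close>, a walk first follows edges of \<open>G\<close> and then takes a non-edge of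
  cost \<open>k \<ge> 1\<close> to a vertex from which it continues with budget \<open>\<beta> - k\<close>. Therefore the matrix
  \<open>D\<^sub>\<beta>\<close> of distances is the min-plus product of \<open>D\<^sub>0\<close> with the matrix of the walks that are trivial
  or start with a non-edge, and the latter is read off the lower layers. Iterating
  \<open>D\<^sub>\<beta> u v := min (D\<^sub>\<beta> u v) (D\<^sub>0 u k + D\<^sub>\<beta> k v)\<close> over all \<open>k\<close>, \<open>u\<close>, \<open>v\<close> computes this product in
  place if \<open>\<beta> > 0\<close>, while for \<open>\<beta> = 0\<close> it is the Floyd--Warshall algorithm; so a layer takes
  \<open>O(n\<^sup>3)\<close> time and no priority queue is needed. A first step of a shortest walk is stored for every
  \<open>\<beta>\<close>, \<open>u\<close>, \<open>v\<close>, which allows writing each path in \<open>O(n)\<close> time.\<close>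

section \<open>A small imperative language on the word RAM\<close>

text \<open>The factor \<open>n\<close> dominates the tie-breaking summand 1 because a simple walk
  has fewer than \<open>n\<close> edges. Two obstacles shape the rest. An in-place update reads
  cells that the same round may have changed already, so no exact intermediate matrix is maintained:
  every cell stays at least the true distance and at most the value that an undisturbed computation
  would give, and equality only emerges when a layer is finished. Moreover the machine gets stuck on
  overflow or on a bad address, so unreachability is a finite sentinel just above the length of
  every simple walk, and each expression has to be shown to fit into a word. A structured language
  with a compiler keeps this manageable: loop-free code is handled by weakest preconditions with a
  time bound read off its size, loops by invariants. Closing a layer relaxes over intermediate
  vertices, which reveals no first step; hence first steps are found by a separate pass over the
  finished distances. Since an answer begins with its length and the output is not stored, each
  route is followed twice, right after its layer is complete.\<close>

datatype exp = Num nat | Var nat | Plus exp exp | Minus exp exp | Times exp exp | Ld exp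

datatype com =
    Assign nat exp
  | Sto exp exp
  | Out exp
  | Seq com com (infixr ";;" 60)
  | If exp exp com com
  | While exp exp com

record state =
  vs :: "nat \<Rightarrow> nat"
  ms :: "nat \<Rightarrow> nat"
  os :: "nat list"

fun ev :: "exp \<Rightarrow> state \<Rightarrow> nat" where
  "ev (Num k) s = k"
| "ev (Var x) s = vs s x"
| "ev (Plus a b) s = ev a s + ev b s"
| "ev (Minus a b) s = ev a s - ev b s"
| "ev (Times a b) s = ev a s * ev b s"
| "ev (Ld a) s = ms s (ev a s)"

text \<open>A variable is always fine because it is kept in a register, which holds a word.\<close>

fun ok :: "nat \<Rightarrow> nat \<Rightarrow> exp \<Rightarrow> state \<Rightarrow> bool" where
  "ok S W (Num k) s \<longleftrightarrow> k < W"
| "ok S W (Var x) s \<longleftrightarrow> True"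
| "ok S W (Plus a b) s \<longleftrightarrow> ok S W a s \<and> ok S W b s \<and> ev a s + ev b s < W"
| "ok S W (Minus a b) s \<longleftrightarrow> ok S W a s \<and> ok S W b s"
| "ok S W (Times a b) s \<longleftrightarrow> ok S W a s \<and> ok S W b s \<and> ev a s * ev b s < W"
| "ok S W (Ld a) s \<longleftrightarrow> ok S W a s \<and> ev a s < S \<and> ms s (ev a s) < W"

text \<open>Variables live in the even registers, temporaries in the odd ones.\<close>

fun cexp :: "nat \<Rightarrow> exp \<Rightarrow> instr list" where
  "cexp t (Num k) = [Const (2 * t + 1) k]"
| "cexp t (Var x) = [Const (2 * t + 1) 0, Add (2 * t + 1) (2 * t + 1) (2 * x)]"
| "cexp t (Plus a b) = cexp t a @ cexp (Suc t) b @ [Add (2 * t + 1) (2 * t + 1) (2 * Suc t + 1)]"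
| "cexp t (Minus a b) = cexp t a @ cexp (Suc t) b @ [Sub (2 * t + 1) (2 * t + 1) (2 * Suc t + 1)]"
| "cexp t (Times a b) = cexp t a @ cexp (Suc t) b @ [Mul (2 * t + 1) (2 * t + 1) (2 * Suc t + 1)]"
| "cexp t (Ld a) = cexp t a @ [Load (2 * t + 1) (2 * t + 1)]"

fun esize :: "exp \<Rightarrow> nat" where
  "esize (Num k) = 1"
| "esize (Var x) = 2"
| "esize (Plus a b) = esize a + esize b + 1"
| "esize (Minus a b) = esize a + esize b + 1"
| "esize (Times a b) = esize a + esize b + 1"
| "esize (Ld a) = esize a + 1"

lemma length_cexp [simp]: "length (cexp t e) = esize e"
  by (induction e arbitrary: t) auto

fun csize :: "com \<Rightarrow> nat" where
  "csize (Assign x e) = esize e + 2"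
| "csize (Sto a e) = esize a + esize e + 1"
| "csize (Out e) = esize e + 1"
| "csize (c1 ;; c2) = csize c1 + csize c2"
| "csize (If a b c1 c2) = esize a + esize b + 2 + csize c1 + csize c2"
| "csize (While a b c) = esize a + esize b + 3 + csize c"

text \<open>Jump targets are absolute, so the start address \<open>l\<close> is passed along. The
  else branch comes first because \<open>Jump_Less\<close> jumps when the test holds; in a loop it
  jumps over the exit jump. Registers 1 and 3 are the temporaries numbered 0 and 1, which receive
  the two operands.\<close>

fun compile :: "nat \<Rightarrow> com \<Rightarrow> instr list" where
  "compile l (Assign x e) = cexp 0 e @ [Const (2 * x) 0, Add (2 * x) (2 * x) 1]"
| "compile l (Sto a e) = cexp 0 a @ cexp 1 e @ [Store 1 3]"
| "compile l (Out e) = cexp 0 e @ [Write 1]"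
| "compile l (c1 ;; c2) = compile l c1 @ compile (l + csize c1) c2"
| "compile l (If a b c1 c2) =
     (let k = l + esize a + esize b in
      cexp 0 a @ cexp 1 b @ [Jump_Less 1 3 (k + 2 + csize c2)] @ compile (k + 1) c2
      @ [Jump (k + 2 + csize c2 + csize c1)] @ compile (k + 2 + csize c2) c1)"
| "compile l (While a b c) =
     (let k = l + esize a + esize b in
      cexp 0 a @ cexp 1 b @ [Jump_Less 1 3 (k + 2), Jump (k + 3 + csize c)]
      @ compile (k + 2) c @ [Jump l])"

lemma length_compile [simp]: "length (compile l c) = csize c"
  by (induction c arbitrary: l) (auto simp: Let_def)

text \<open>The bound on all registers makes copying and subtraction safe by itself. Memory carries
  no such bound, which is why \<open>ok\<close> asks for one at every load.\<close>

definition represents :: "nat \<Rightarrow> state \<Rightarrow> config \<Rightarrow> bool" where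
  "represents W s q \<longleftrightarrow>
     (\<forall>x. regs q (2 * x) = vs s x) \<and> mem q = ms s \<and> out q = os s \<and> (\<forall>r. regs q r < W)"

text \<open>A total-correctness triple with a time budget. The surrounding code \<open>pre\<close>
  and \<open>post\<close> is arbitrary, so that a fact about a command applies wherever the command
  ends up in a larger program.\<close>

definition run ::
    "nat \<Rightarrow> nat \<Rightarrow> com \<Rightarrow> nat \<Rightarrow> (state \<Rightarrow> bool) \<Rightarrow> state \<Rightarrow> bool" where
  "run S W c T Q s \<longleftrightarrow>
     (\<forall>pre post q. represents W s q \<longrightarrow> pc q = length pre \<longrightarrow>
        (\<exists>t q' s'. t \<le> T \<and> exec_steps S W (pre @ compile (length pre) c @ post) t q = Some q'
           \<and> pc q' = length pre + csize c \<and> represents W s' q' \<and> Q s'))"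

section \<open>Machine steps and compiled expressions\<close>

lemma exec_steps_trans:
  assumes "exec_steps S W prog t q = Some q'" "exec_steps S W prog t' q' = Some q''"
  shows "exec_steps S W prog (t + t') q = Some q''"
  using assms by (induction t arbitrary: q) (auto split: if_splits option.splits bind_splits)

lemma exec_steps_1:
  assumes "pc q = length pre"
  shows "exec_steps S W (pre @ i # post) 1 q = exec_instr S W i q"
  using assms by (cases "exec_instr S W i q") (auto simp: nth_append)

lemma represents_regD: "represents W s q \<Longrightarrow> regs q r < W"
  by (simp add: represents_def)

lemma represents_varD: "represents W s q \<Longrightarrow> regs q (2 * x) = vs s x"
  by (simp add: represents_def)

lemma represents_W_pos: "represents W s q \<Longrightarrow> 0 < W"
  unfolding represents_def by (metis less_nat_zero_code not_gr0)

lemma represents_pc [simp]: "represents W s (q\<lparr>pc := l\<rparr>) = represents W s q"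
  by (simp add: represents_def)

lemma set_tmp:
  assumes "represents W s q" "x < W"
  obtains q' where "set_reg W (Suc (2 * t)) x q = Some q'" "represents W s q'"
    "pc q' = Suc (pc q)" "regs q' = (regs q)(Suc (2 * t) := x)"
proof -
  have "2 * y \<noteq> Suc (2 * t)" for y
    by presburger
  with assms show ?thesis
    by (intro that[of "next_pc (q\<lparr>regs := (regs q)(Suc (2 * t) := x)\<rparr>)"])
      (auto simp: set_reg_def next_pc_def represents_def)
qed

text \<open>The last conjunct is what makes the induction work for binary operators: evaluating the
  second operand with temporary \<open>Suc t\<close> must leave the first result in temporary
  \<open>t\<close> alone.\<close>

lemma cexp_correct:
  assumes "represents W s q" "ok S W e s" "pc q = length pre"
  shows "\<exists>q'. exec_steps S W (pre @ cexp t e @ post) (esize e) q = Some q'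
     \<and> pc q' = length pre + esize e \<and> represents W s q' \<and> regs q' (2 * t + 1) = ev e s
     \<and> (\<forall>t'<t. regs q' (2 * t' + 1) = regs q (2 * t' + 1))"
  using assms
proof (induction e arbitrary: q pre post t)
  case (Num k)
  then obtain q' where "set_reg W (Suc (2 * t)) k q = Some q'" "represents W s q'"
    "pc q' = Suc (pc q)" "regs q' = (regs q)(Suc (2 * t) := k)"
    using set_tmp[of W s q k t] by auto
  with Num show ?case
    using exec_steps_1[of q pre S W] by auto
next
  case (Var x)
  obtain q1 where q1: "set_reg W (Suc (2 * t)) 0 q = Some q1" "represents W s q1"
    "pc q1 = Suc (pc q)" "regs q1 = (regs q)(Suc (2 * t) := 0)"
    using set_tmp[of W s q 0 t] represents_W_pos Var.prems by metis
  have *: "vs s x < W"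
    using Var.prems(1) represents_regD represents_varD by metis
  obtain q2 where q2: "set_reg W (Suc (2 * t)) (vs s x) q1 = Some q2" "represents W s q2"
    "pc q2 = Suc (pc q1)" "regs q2 = (regs q1)(Suc (2 * t) := vs s x)"
    using set_tmp[of W s q1 "vs s x" t] q1 * by auto
  have 1: "exec_steps S W (pre @ cexp t (Var x) @ post) 1 q = Some q1"
    using exec_steps_1[of q pre S W] Var.prems q1 by simp
  have "exec_steps S W ((pre @ [Const (2 * t + 1) 0]) @ Add (2 * t + 1) (2 * t + 1) (2 * x) # post) 1 q1
      = Some q2"
    using q1 q2 Var.prems(3) represents_varD[OF q1(2), of x]
    by (subst exec_steps_1) auto
  then have 2: "exec_steps S W (pre @ cexp t (Var x) @ post) 1 q1 = Some q2"
    by simp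
  have "exec_steps S W (pre @ cexp t (Var x) @ post) (1 + 1) q = Some q2"
    by (rule exec_steps_trans[OF 1 2])
  then have "exec_steps S W (pre @ cexp t (Var x) @ post) (esize (Var x)) q = Some q2"
    by (simp only: esize.simps one_add_one)
  with q1 q2 Var.prems show ?case by auto
next
  case (Ld a)
  obtain q1 where q1: "exec_steps S W (pre @ cexp t a @ Load (2 * t + 1) (2 * t + 1) # post) (esize a) q = Some q1"
    "pc q1 = length pre + esize a" "represents W s q1" "regs q1 (2 * t + 1) = ev a s"
    "\<forall>t'<t. regs q1 (2 * t' + 1) = regs q (2 * t' + 1)"
    using Ld.IH[of q pre t] Ld.prems by auto
  obtain q2 where q2: "set_reg W (Suc (2 * t)) (ms s (ev a s)) q1 = Some q2" "represents W s q2"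
    "pc q2 = Suc (pc q1)" "regs q2 = (regs q1)(Suc (2 * t) := ms s (ev a s))"
    using set_tmp[of W s q1 "ms s (ev a s)" t] q1 Ld.prems by auto
  have "exec_steps S W ((pre @ cexp t a) @ Load (2 * t + 1) (2 * t + 1) # post) 1 q1 = Some q2"
    using q1 q2 Ld.prems by (subst exec_steps_1) (auto simp: represents_def)
  then have "exec_steps S W (pre @ cexp t (Ld a) @ post) (esize (Ld a)) q = Some q2"
    using exec_steps_trans[OF q1(1), of 1 q2] by simp
  with q1 q2 show ?case by auto
next
  case (Plus a b)
  let ?i = "Add (2 * t + 1) (2 * t + 1) (2 * Suc t + 1)"
  let ?p = "pre @ cexp t a @ cexp (Suc t) b @ ?i # post"
  obtain q1 where q1: "exec_steps S W ?p (esize a) q = Some q1"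
    "pc q1 = length pre + esize a" "represents W s q1" "regs q1 (2 * t + 1) = ev a s"
    "\<forall>t'<t. regs q1 (2 * t' + 1) = regs q (2 * t' + 1)"
    using Plus.IH(1)[of q pre t] Plus.prems by auto
  obtain q2 where q2: "exec_steps S W ((pre @ cexp t a) @ cexp (Suc t) b @ ?i # post) (esize b) q1 = Some q2"
    "pc q2 = length pre + esize a + esize b" "represents W s q2" "regs q2 (2 * Suc t + 1) = ev b s"
    "\<forall>t'<Suc t. regs q2 (2 * t' + 1) = regs q1 (2 * t' + 1)"
    using Plus.IH(2)[of q1 "pre @ cexp t a" "Suc t" "?i # post"] Plus.prems q1
    by (auto simp: algebra_simps)
  obtain q3 where q3: "set_reg W (Suc (2 * t)) (ev a s + ev b s) q2 = Some q3" "represents W s q3"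
    "pc q3 = Suc (pc q2)" "regs q3 = (regs q2)(Suc (2 * t) := ev a s + ev b s)"
    using set_tmp[of W s q2 "ev a s + ev b s" t] q2 Plus.prems by auto
  have "exec_steps S W ((pre @ cexp t a @ cexp (Suc t) b) @ ?i # post) 1 q2 = Some q3"
    using q1 q2 q3 by (subst exec_steps_1) auto
  then have "exec_steps S W ?p (esize a + (esize b + 1)) q = Some q3"
    by (intro exec_steps_trans[OF q1(1)] exec_steps_trans[of _ _ _ _ _ q2]) (use q2 in auto)
  with q1 q2 q3 show ?case by (auto simp: algebra_simps)
next
  case (Minus a b)
  let ?i = "Sub (2 * t + 1) (2 * t + 1) (2 * Suc t + 1)"
  let ?p = "pre @ cexp t a @ cexp (Suc t) b @ ?i # post"
  obtain q1 where q1: "exec_steps S W ?p (esize a) q = Some q1"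
    "pc q1 = length pre + esize a" "represents W s q1" "regs q1 (2 * t + 1) = ev a s"
    "\<forall>t'<t. regs q1 (2 * t' + 1) = regs q (2 * t' + 1)"
    using Minus.IH(1)[of q pre t] Minus.prems by auto
  obtain q2 where q2: "exec_steps S W ((pre @ cexp t a) @ cexp (Suc t) b @ ?i # post) (esize b) q1 = Some q2"
    "pc q2 = length pre + esize a + esize b" "represents W s q2" "regs q2 (2 * Suc t + 1) = ev b s"
    "\<forall>t'<Suc t. regs q2 (2 * t' + 1) = regs q1 (2 * t' + 1)"
    using Minus.IH(2)[of q1 "pre @ cexp t a" "Suc t" "?i # post"] Minus.prems q1
    by (auto simp: algebra_simps)
  \<comment> \<open>The difference is at most the left operand, which was computed into a register
    and is therefore a word.\<close>
  have "ev a s - ev b s < W"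
    using q1(4) represents_regD[OF q1(3), of "2 * t + 1"] by linarith
  then obtain q3 where q3: "set_reg W (Suc (2 * t)) (ev a s - ev b s) q2 = Some q3" "represents W s q3"
    "pc q3 = Suc (pc q2)" "regs q3 = (regs q2)(Suc (2 * t) := ev a s - ev b s)"
    using set_tmp[of W s q2 "ev a s - ev b s" t] q2 Minus.prems by auto
  have "exec_steps S W ((pre @ cexp t a @ cexp (Suc t) b) @ ?i # post) 1 q2 = Some q3"
    using q1 q2 q3 by (subst exec_steps_1) auto
  then have "exec_steps S W ?p (esize a + (esize b + 1)) q = Some q3"
    by (intro exec_steps_trans[OF q1(1)] exec_steps_trans[of _ _ _ _ _ q2]) (use q2 in auto)
  with q1 q2 q3 show ?case by (auto simp: algebra_simps)
next
  case (Times a b)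
  let ?i = "Mul (2 * t + 1) (2 * t + 1) (2 * Suc t + 1)"
  let ?p = "pre @ cexp t a @ cexp (Suc t) b @ ?i # post"
  obtain q1 where q1: "exec_steps S W ?p (esize a) q = Some q1"
    "pc q1 = length pre + esize a" "represents W s q1" "regs q1 (2 * t + 1) = ev a s"
    "\<forall>t'<t. regs q1 (2 * t' + 1) = regs q (2 * t' + 1)"
    using Times.IH(1)[of q pre t] Times.prems by auto
  obtain q2 where q2: "exec_steps S W ((pre @ cexp t a) @ cexp (Suc t) b @ ?i # post) (esize b) q1 = Some q2"
    "pc q2 = length pre + esize a + esize b" "represents W s q2" "regs q2 (2 * Suc t + 1) = ev b s"
    "\<forall>t'<Suc t. regs q2 (2 * t' + 1) = regs q1 (2 * t' + 1)"
    using Times.IH(2)[of q1 "pre @ cexp t a" "Suc t" "?i # post"] Times.prems q1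
    by (auto simp: algebra_simps)
  obtain q3 where q3: "set_reg W (Suc (2 * t)) (ev a s * ev b s) q2 = Some q3" "represents W s q3"
    "pc q3 = Suc (pc q2)" "regs q3 = (regs q2)(Suc (2 * t) := ev a s * ev b s)"
    using set_tmp[of W s q2 "ev a s * ev b s" t] q2 Times.prems by auto
  have "exec_steps S W ((pre @ cexp t a @ cexp (Suc t) b) @ ?i # post) 1 q2 = Some q3"
    using q1 q2 q3 by (subst exec_steps_1) auto
  then have "exec_steps S W ?p (esize a + (esize b + 1)) q = Some q3"
    by (intro exec_steps_trans[OF q1(1)] exec_steps_trans[of _ _ _ _ _ q2]) (use q2 in auto)
  with q1 q2 q3 show ?case by (auto simp: algebra_simps)
qed

lemma cexp2_correct:
  assumes "represents W s q" "ok S W a s" "ok S W b s" "pc q = length pre"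
  obtains q' where "exec_steps S W (pre @ cexp 0 a @ cexp 1 b @ post) (esize a + esize b) q = Some q'"
    "pc q' = length pre + esize a + esize b" "represents W s q'" "regs q' 1 = ev a s" "regs q' 3 = ev b s"
proof -
  obtain q1 where q1: "exec_steps S W (pre @ cexp 0 a @ cexp 1 b @ post) (esize a) q = Some q1"
    "pc q1 = length pre + esize a" "represents W s q1" "regs q1 1 = ev a s"
    using cexp_correct[OF assms(1,2,4), of 0 "cexp 1 b @ post"] by auto
  obtain q2 where "exec_steps S W ((pre @ cexp 0 a) @ cexp 1 b @ post) (esize b) q1 = Some q2"
    "pc q2 = length (pre @ cexp 0 a) + esize b" "represents W s q2" "regs q2 3 = ev b s" "regs q2 1 = regs q1 1"
    using cexp_correct[OF q1(3) assms(3), of "pre @ cexp 0 a" 1 post] q1(2) by (auto simp: eval_nat_numeral)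
  with q1 that[of q2] show ?thesis
    using exec_steps_trans by fastforce
qed

section \<open>Timed rules for commands\<close>

lemma run_mono:
  assumes "run S W c T Q s" "T \<le> T'" "\<And>s'. Q s' \<Longrightarrow> Q' s'"
  shows "run S W c T' Q' s"
  using assms unfolding run_def by (meson order_trans)

lemma run_Seq:
  assumes "run S W c1 T1 R s" "\<And>s'. R s' \<Longrightarrow> run S W c2 T2 Q s'" "T1 + T2 \<le> T"
  shows "run S W (c1 ;; c2) T Q s"
  unfolding run_def
proof (intro allI impI)
  fix pre post :: "instr list" and q
  assume "represents W s q" "pc q = length pre"
  then obtain t1 q1 s1 where 1: "t1 \<le> T1"
    "exec_steps S W (pre @ compile (length pre) c1 @ compile (length pre + csize c1) c2 @ post) t1 q = Some q1"
    "pc q1 = length pre + csize c1" "represents W s1 q1" "R s1"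
    using assms(1) unfolding run_def by blast
  have "pc q1 = length (pre @ compile (length pre) c1)"
    using 1 by simp
  then obtain t2 q2 s2 where 2: "t2 \<le> T2"
    "exec_steps S W ((pre @ compile (length pre) c1) @ compile (length (pre @ compile (length pre) c1)) c2 @ post) t2 q1 = Some q2"
    "pc q2 = length (pre @ compile (length pre) c1) + csize c2" "represents W s2 q2" "Q s2"
    using assms(2)[OF 1(5)] 1(4) unfolding run_def by blast
  show "\<exists>t q' s'. t \<le> T \<and> exec_steps S W (pre @ compile (length pre) (c1 ;; c2) @ post) t q = Some q'
           \<and> pc q' = length pre + csize (c1 ;; c2) \<and> represents W s' q' \<and> Q s'"
    using exec_steps_trans[OF 1(2), of t2 q2] 1 2 assms(3)
    by (intro exI[of _ "t1 + t2"] exI[of _ q2] exI[of _ s2]) auto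
qed

lemma run_Assign:
  assumes "ok S W e s" "Q (s\<lparr>vs := (vs s)(x := ev e s)\<rparr>)"
  shows "run S W (Assign x e) (esize e + 2) Q s"
  unfolding run_def
proof (intro allI impI)
  fix pre post :: "instr list" and q
  assume q: "represents W s q" "pc q = length pre"
  let ?p = "pre @ compile (length pre) (Assign x e) @ post"
  let ?s = "s\<lparr>vs := (vs s)(x := ev e s)\<rparr>"
  obtain q1 where q1: "exec_steps S W ?p (esize e) q = Some q1"
    "pc q1 = length pre + esize e" "represents W s q1" "regs q1 1 = ev e s"
    using cexp_correct[OF q(1) assms(1) q(2), of 0 "[Const (2 * x) 0, Add (2 * x) (2 * x) 1] @ post"] by auto
  define q2 where "q2 = next_pc (q1\<lparr>regs := (regs q1)(2 * x := 0)\<rparr>)"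
  define q3 where "q3 = next_pc (q2\<lparr>regs := (regs q2)(2 * x := ev e s)\<rparr>)"
  have e: "ev e s < W"
    using represents_regD[OF q1(3), of 1] q1(4) by simp
  \<comment> \<open>The variable's register is zeroed before the result is added to it, so it must
    differ from register 1, where the result is waiting.\<close>
  have ne: "2 * x \<noteq> 1" by presburger
  have 2: "exec_steps S W ((pre @ cexp 0 e) @ Const (2 * x) 0 # Add (2 * x) (2 * x) 1 # post) 1 q1 = Some q2"
    using e q1(2) by (subst exec_steps_1) (auto simp: set_reg_def q2_def)
  have 3: "exec_steps S W ((pre @ cexp 0 e @ [Const (2 * x) 0]) @ Add (2 * x) (2 * x) 1 # post) 1 q2 = Some q3"
    using e q1 ne by (subst exec_steps_1) (auto simp: set_reg_def q2_def q3_def next_pc_def)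
  have 4: "exec_steps S W ?p (esize e + (1 + 1)) q = Some q3"
    by (intro exec_steps_trans[OF q1(1)] exec_steps_trans[of _ _ _ 1 _ q2]) (use 2 3 in simp_all)
  have 5: "pc q3 = length pre + csize (Assign x e)"
    using q1 by (simp add: q2_def q3_def next_pc_def)
  have "represents W ?s q3"
    using q1(3) e by (auto simp: represents_def q2_def q3_def next_pc_def)
  with 4 5 assms(2)
  show "\<exists>t q' s'. t \<le> esize e + 2 \<and> exec_steps S W ?p t q = Some q'
           \<and> pc q' = length pre + csize (Assign x e) \<and> represents W s' q' \<and> Q s'"
    by (intro exI[of _ "esize e + (1 + 1)"] exI[of _ q3] exI[of _ ?s]) simp
qed

lemma run_Sto:
  assumes "ok S W a s" "ok S W e s" "ev a s < S" "Q (s\<lparr>ms := (ms s)(ev a s := ev e s)\<rparr>)"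
  shows "run S W (Sto a e) (esize a + esize e + 1) Q s"
  unfolding run_def
proof (intro allI impI)
  fix pre post :: "instr list" and q
  assume q: "represents W s q" "pc q = length pre"
  let ?p = "pre @ compile (length pre) (Sto a e) @ post"
  let ?s = "s\<lparr>ms := (ms s)(ev a s := ev e s)\<rparr>"
  obtain q1 where q1: "exec_steps S W (pre @ cexp 0 a @ cexp 1 e @ [Store 1 3] @ post) (esize a + esize e) q = Some q1"
    "pc q1 = length pre + esize a + esize e" "represents W s q1" "regs q1 1 = ev a s" "regs q1 3 = ev e s"
    using cexp2_correct[OF q(1) assms(1,2) q(2)] by blast
  define q2 where "q2 = next_pc (q1\<lparr>mem := (mem q1)(ev a s := ev e s)\<rparr>)"
  have 2: "exec_steps S W ((pre @ cexp 0 a @ cexp 1 e) @ Store 1 3 # post) 1 q1 = Some q2"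
    using q1 assms(3) by (subst exec_steps_1) (auto simp: q2_def)
  have 3: "exec_steps S W ?p (esize a + esize e + 1) q = Some q2"
    using exec_steps_trans[of S W ?p _ q q1 1 q2] q1(1) 2 by simp
  have "represents W ?s q2"
    using q1(3) by (auto simp: represents_def q2_def next_pc_def)
  with 3 assms(4) q1(2)
  show "\<exists>t q' s'. t \<le> esize a + esize e + 1 \<and> exec_steps S W ?p t q = Some q'
           \<and> pc q' = length pre + csize (Sto a e) \<and> represents W s' q' \<and> Q s'"
    by (intro exI[of _ "esize a + esize e + 1"] exI[of _ q2] exI[of _ ?s]) (simp add: q2_def next_pc_def)
qed

lemma run_Out:
  assumes "ok S W e s" "Q (s\<lparr>os := os s @ [ev e s]\<rparr>)"
  shows "run S W (Out e) (esize e + 1) Q s"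
  unfolding run_def
proof (intro allI impI)
  fix pre post :: "instr list" and q
  assume q: "represents W s q" "pc q = length pre"
  let ?p = "pre @ compile (length pre) (Out e) @ post"
  let ?s = "s\<lparr>os := os s @ [ev e s]\<rparr>"
  obtain q1 where q1: "exec_steps S W ?p (esize e) q = Some q1"
    "pc q1 = length pre + esize e" "represents W s q1" "regs q1 1 = ev e s"
    using cexp_correct[OF q(1) assms(1) q(2), of 0 "Write 1 # post"] by auto
  define q2 where "q2 = next_pc (q1\<lparr>out := out q1 @ [ev e s]\<rparr>)"
  have 2: "exec_steps S W ((pre @ cexp 0 e) @ Write 1 # post) 1 q1 = Some q2"
    using q1 by (subst exec_steps_1) (auto simp: q2_def)
  have 3: "exec_steps S W ?p (esize e + 1) q = Some q2"
    using exec_steps_trans[of S W ?p _ q q1 1 q2] q1(1) 2 by simp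
  have "represents W ?s q2"
    using q1(3) by (auto simp: represents_def q2_def next_pc_def)
  with 3 assms(2) q1(2)
  show "\<exists>t q' s'. t \<le> esize e + 1 \<and> exec_steps S W ?p t q = Some q'
           \<and> pc q' = length pre + csize (Out e) \<and> represents W s' q' \<and> Q s'"
    by (intro exI[of _ "esize e + 1"] exI[of _ q2] exI[of _ ?s]) (simp add: q2_def next_pc_def)
qed

lemma run_If:
  assumes "ok S W a s" "ok S W b s"
    and "ev a s < ev b s \<Longrightarrow> run S W c1 T Q s" "\<not> ev a s < ev b s \<Longrightarrow> run S W c2 T Q s"
  shows "run S W (If a b c1 c2) (esize a + esize b + 2 + T) Q s"
  unfolding run_def
proof (intro allI impI)
  fix pre post :: "instr list" and q
  assume q: "represents W s q" "pc q = length pre"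
  let ?p = "pre @ compile (length pre) (If a b c1 c2) @ post"
  define k where "k = length pre + esize a + esize b"
  define j where "j = Jump_Less 1 3 (k + 2 + csize c2)"
  define l where "l = Jump (k + 2 + csize c2 + csize c1)"
  have p: "?p = pre @ cexp 0 a @ cexp 1 b @ j # compile (k + 1) c2 @ l # compile (k + 2 + csize c2) c1 @ post"
    by (simp add: k_def j_def l_def Let_def)
  obtain q1 where q1: "exec_steps S W ?p (esize a + esize b) q = Some q1"
    "pc q1 = k" "represents W s q1" "regs q1 1 = ev a s" "regs q1 3 = ev b s"
    unfolding p k_def using cexp2_correct[OF q(1) assms(1,2) q(2)] by (metis (no_types))
  have j: "exec_steps S W ?p 1 q1 = exec_instr S W j q1"
    using exec_steps_1[of q1 "pre @ cexp 0 a @ cexp 1 b"] q1(2) unfolding p k_def by simp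
  show "\<exists>t q' s'. t \<le> esize a + esize b + 2 + T \<and> exec_steps S W ?p t q = Some q'
           \<and> pc q' = length pre + csize (If a b c1 c2) \<and> represents W s' q' \<and> Q s'"
  proof (cases "ev a s < ev b s")
    case True
    \<comment> \<open>All code in front of the chosen branch becomes its prefix; the jump lands
      correctly because its target is the length of this prefix.\<close>
    define pre' where "pre' = pre @ cexp 0 a @ cexp 1 b @ j # compile (k + 1) c2 @ [l]"
    have len: "length pre' = k + 2 + csize c2"
      by (simp add: pre'_def k_def)
    have 1: "exec_steps S W ?p 1 q1 = Some (q1\<lparr>pc := length pre'\<rparr>)"
      using True q1 unfolding j by (simp add: j_def len)
    have q': "represents W s (q1\<lparr>pc := length pre'\<rparr>)" "pc (q1\<lparr>pc := length pre'\<rparr>) = length pre'"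
      using q1(3) by simp_all
    then obtain t q2 s2 where 2: "t \<le> T"
        "exec_steps S W (pre' @ compile (length pre') c1 @ post) t (q1\<lparr>pc := length pre'\<rparr>) = Some q2"
        "pc q2 = length pre' + csize c1" "represents W s2 q2" "Q s2"
      using assms(3)[OF True] q' unfolding run_def by blast
    have "?p = pre' @ compile (length pre') c1 @ post"
      unfolding p len by (simp add: pre'_def)
    then have "exec_steps S W ?p t (q1\<lparr>pc := length pre'\<rparr>) = Some q2"
      using 2(2) by (simp only:)
    then have "exec_steps S W ?p (esize a + esize b + (1 + t)) q = Some q2"
      by (intro exec_steps_trans[OF q1(1)] exec_steps_trans[OF 1])
    with 2 show ?thesis
      by (intro exI[of _ "esize a + esize b + (1 + t)"] exI[of _ q2] exI[of _ s2])
        (auto simp: len k_def)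
  next
    case False
    define pre' where "pre' = pre @ cexp 0 a @ cexp 1 b @ [j]"
    have len: "length pre' = k + 1"
      by (simp add: pre'_def k_def)
    have 1: "exec_steps S W ?p 1 q1 = Some (q1\<lparr>pc := length pre'\<rparr>)"
      using False q1 unfolding j by (simp add: j_def len next_pc_def)
    have q': "represents W s (q1\<lparr>pc := length pre'\<rparr>)" "pc (q1\<lparr>pc := length pre'\<rparr>) = length pre'"
      using q1(3) by simp_all
    then obtain t q2 s2 where 2: "t \<le> T"
        "exec_steps S W (pre' @ compile (length pre') c2 @ l # compile (k + 2 + csize c2) c1 @ post) t (q1\<lparr>pc := length pre'\<rparr>) = Some q2"
        "pc q2 = length pre' + csize c2" "represents W s2 q2" "Q s2"
      using assms(4)[OF False] q' unfolding run_def by blast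
    have p': "?p = pre' @ compile (length pre') c2 @ l # compile (k + 2 + csize c2) c1 @ post"
      unfolding p len by (simp add: pre'_def)
    have 3: "exec_steps S W ?p 1 q2 = exec_instr S W l q2"
      using exec_steps_1[of q2 "pre' @ compile (length pre') c2"] 2(3) unfolding p' by simp
    define q3 where "q3 = q2\<lparr>pc := k + 2 + csize c2 + csize c1\<rparr>"
    have "exec_steps S W ?p 1 q2 = Some q3"
      unfolding 3 by (simp add: l_def q3_def)
    then have 4: "exec_steps S W ?p (t + 1) (q1\<lparr>pc := length pre'\<rparr>) = Some q3"
      using 2(2) by (intro exec_steps_trans) (simp only: p')
    have "exec_steps S W ?p (esize a + esize b + (1 + (t + 1))) q = Some q3"
      by (intro exec_steps_trans[OF q1(1)] exec_steps_trans[OF 1] 4)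
    with 2 show ?thesis
      by (intro exI[of _ "esize a + esize b + (1 + (t + 1))"] exI[of _ q3] exI[of _ s2])
        (auto simp: len k_def q3_def)
  qed
qed

lemma run_While_False:
  assumes "ok S W a s" "ok S W b s" "\<not> ev a s < ev b s" "Q s"
  shows "run S W (While a b c) (esize a + esize b + 2) Q s"
  unfolding run_def
proof (intro allI impI)
  fix pre post :: "instr list" and q
  assume q: "represents W s q" "pc q = length pre"
  let ?p = "pre @ compile (length pre) (While a b c) @ post"
  define k where "k = length pre + esize a + esize b"
  define j where "j = Jump_Less 1 3 (k + 2)"
  define l where "l = Jump (k + 3 + csize c)"
  have p: "?p = pre @ cexp 0 a @ cexp 1 b @ j # l # compile (k + 2) c @ Jump (length pre) # post"
    by (simp add: k_def j_def l_def Let_def)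
  obtain q1 where q1: "exec_steps S W ?p (esize a + esize b) q = Some q1"
    "pc q1 = k" "represents W s q1" "regs q1 1 = ev a s" "regs q1 3 = ev b s"
    unfolding p k_def using cexp2_correct[OF q(1) assms(1,2) q(2)] by (metis (no_types))
  define q2 where "q2 = q1\<lparr>pc := k + 1\<rparr>"
  define q3 where "q3 = q1\<lparr>pc := k + 3 + csize c\<rparr>"
  have "exec_steps S W ?p 1 q1 = exec_instr S W j q1"
    using exec_steps_1[of q1 "pre @ cexp 0 a @ cexp 1 b"] q1(2) unfolding p k_def by simp
  also have "\<dots> = Some q2"
    using assms(3) q1 by (simp add: j_def q2_def next_pc_def)
  finally have 2: "exec_steps S W ?p 1 q1 = Some q2" .
  have "exec_steps S W ?p 1 q2 = exec_instr S W l q2"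
    using exec_steps_1[of q2 "pre @ cexp 0 a @ cexp 1 b @ [j]"] unfolding p q2_def k_def by simp
  also have "\<dots> = Some q3"
    by (simp add: l_def q2_def q3_def)
  finally have 3: "exec_steps S W ?p 1 q2 = Some q3" .
  have "exec_steps S W ?p (esize a + esize b + (1 + 1)) q = Some q3"
    by (intro exec_steps_trans[OF q1(1)] exec_steps_trans[OF 2] 3)
  then show "\<exists>t q' s'. t \<le> esize a + esize b + 2 \<and> exec_steps S W ?p t q = Some q'
           \<and> pc q' = length pre + csize (While a b c) \<and> represents W s' q' \<and> Q s'"
    using q1 assms(4)
    by (intro exI[of _ "esize a + esize b + (1 + 1)"] exI[of _ q3] exI[of _ s]) (auto simp: q3_def k_def)
qed

text \<open>One unrolling of the loop. The remaining iterations enter as an assumption with their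
  own budget \<open>T'\<close>, so that they can be supplied by induction on whatever
  decreases.\<close>

lemma run_While_True:
  assumes "ok S W a s" "ok S W b s" "ev a s < ev b s" "run S W c T R s"
    and "\<And>s'. R s' \<Longrightarrow> run S W (While a b c) T' Q s'"
    and "esize a + esize b + 2 + T + T' \<le> T''"
  shows "run S W (While a b c) T'' Q s"
  unfolding run_def
proof (intro allI impI)
  fix pre post :: "instr list" and q
  assume q: "represents W s q" "pc q = length pre"
  let ?p = "pre @ compile (length pre) (While a b c) @ post"
  define k where "k = length pre + esize a + esize b"
  define j where "j = Jump_Less 1 3 (k + 2)"
  define l where "l = Jump (k + 3 + csize c)"
  have p: "?p = pre @ cexp 0 a @ cexp 1 b @ j # l # compile (k + 2) c @ Jump (length pre) # post"
    by (simp add: k_def j_def l_def Let_def)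
  obtain q1 where q1: "exec_steps S W ?p (esize a + esize b) q = Some q1"
    "pc q1 = k" "represents W s q1" "regs q1 1 = ev a s" "regs q1 3 = ev b s"
    unfolding p k_def using cexp2_correct[OF q(1) assms(1,2) q(2)] by (metis (no_types))
  define pre' where "pre' = pre @ cexp 0 a @ cexp 1 b @ [j, l]"
  have len: "length pre' = k + 2"
    by (simp add: pre'_def k_def)
  have p': "?p = pre' @ compile (length pre') c @ Jump (length pre) # post"
    unfolding p len by (simp add: pre'_def)
  define q2 where "q2 = q1\<lparr>pc := length pre'\<rparr>"
  have "exec_steps S W ?p 1 q1 = exec_instr S W j q1"
    using exec_steps_1[of q1 "pre @ cexp 0 a @ cexp 1 b"] q1(2) unfolding p k_def by simp
  also have "\<dots> = Some q2"
    using assms(3) q1 by (simp add: j_def q2_def len)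
  finally have 2: "exec_steps S W ?p 1 q1 = Some q2" .
  have "represents W s q2" "pc q2 = length pre'"
    using q1 by (simp_all add: q2_def)
  then obtain t3 q3 s3 where 3: "t3 \<le> T" "exec_steps S W ?p t3 q2 = Some q3"
      "pc q3 = length pre' + csize c" "represents W s3 q3" "R s3"
    using assms(4) unfolding run_def p' by blast
  define q4 where "q4 = q3\<lparr>pc := length pre\<rparr>"
  have "exec_steps S W ?p 1 q3 = exec_instr S W (Jump (length pre)) q3"
    using exec_steps_1[of q3 "pre' @ compile (length pre') c"] 3(3) unfolding p' by simp
  then have 4: "exec_steps S W ?p 1 q3 = Some q4"
    by (simp add: q4_def)
  have "represents W s3 q4" "pc q4 = length pre"
    using 3 by (simp_all add: q4_def)
  then obtain t5 q5 s5 where 5: "t5 \<le> T'" "exec_steps S W ?p t5 q4 = Some q5"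
      "pc q5 = length pre + csize (While a b c)" "represents W s5 q5" "Q s5"
    using assms(5)[OF 3(5)] unfolding run_def by blast
  have "exec_steps S W ?p (esize a + esize b + (1 + (t3 + (1 + t5)))) q = Some q5"
    by (intro exec_steps_trans[OF q1(1)] exec_steps_trans[OF 2] exec_steps_trans[OF 3(2)]
        exec_steps_trans[OF 4] 5)
  then show "\<exists>t q' s'. t \<le> T'' \<and> exec_steps S W ?p t q = Some q'
           \<and> pc q' = length pre + csize (While a b c) \<and> represents W s' q' \<and> Q s'"
    using 3 5 assms(6)
    by (intro exI[of _ "esize a + esize b + (1 + (t3 + (1 + t5)))"] exI[of _ q5] exI[of _ s5]) auto
qed

text \<open>Loops are mapped to \<open>False\<close>, so a \<open>wp\<close> fact only ever concerns
  loop-free code and can be evaluated by the simplifier.\<close>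

fun wp :: "nat \<Rightarrow> nat \<Rightarrow> com \<Rightarrow> (state \<Rightarrow> bool) \<Rightarrow> state \<Rightarrow> bool" where
  "wp S W (Assign x e) Q s \<longleftrightarrow> ok S W e s \<and> Q (s\<lparr>vs := (vs s)(x := ev e s)\<rparr>)"
| "wp S W (Sto a e) Q s \<longleftrightarrow>
     ok S W a s \<and> ok S W e s \<and> ev a s < S \<and> Q (s\<lparr>ms := (ms s)(ev a s := ev e s)\<rparr>)"
| "wp S W (Out e) Q s \<longleftrightarrow> ok S W e s \<and> Q (s\<lparr>os := os s @ [ev e s]\<rparr>)"
| "wp S W (c1 ;; c2) Q s \<longleftrightarrow> wp S W c1 (wp S W c2 Q) s"
| "wp S W (If a b c1 c2) Q s \<longleftrightarrow> ok S W a s \<and> ok S W b s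
     \<and> (if ev a s < ev b s then wp S W c1 Q s else wp S W c2 Q s)"
| "wp S W (While a b c) Q s \<longleftrightarrow> False"

text \<open>Without loops every instruction is executed at most once, so the size of the code
  controls the time.\<close>

lemma wp_run: "wp S W c Q s \<Longrightarrow> run S W c (2 * csize c) Q s"
proof (induction c arbitrary: Q s)
  case (Assign x e)
  then show ?case by (intro run_mono[OF run_Assign[where Q = Q]]) auto
next
  case (Sto a e)
  then show ?case by (intro run_mono[OF run_Sto[where Q = Q]]) auto
next
  case (Out e)
  then show ?case by (intro run_mono[OF run_Out[where Q = Q]]) auto
next
  case (Seq c1 c2)
  from Seq.prems have "wp S W c1 (wp S W c2 Q) s" by simp
  from Seq.IH(1)[OF this] show ?case
    by (rule run_Seq) (use Seq.IH(2) in auto)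
next
  case (If a b c1 c2)
  have "run S W (If a b c1 c2) (esize a + esize b + 2 + (2 * csize c1 + 2 * csize c2)) Q s"
  proof (rule run_If)
    assume "ev a s < ev b s"
    then have "run S W c1 (2 * csize c1) Q s" using If by auto
    then show "run S W c1 (2 * csize c1 + 2 * csize c2) Q s" by (rule run_mono) auto
  next
    assume "\<not> ev a s < ev b s"
    then have "run S W c2 (2 * csize c2) Q s" using If by auto
    then show "run S W c2 (2 * csize c1 + 2 * csize c2) Q s" by (rule run_mono) auto
  qed (use If.prems in auto)
  then show ?case by (rule run_mono) auto
next
  case (While a b c)
  then show ?case by simp
qed

definition For :: "nat \<Rightarrow> nat \<Rightarrow> com \<Rightarrow> com" where
  "For x y c = Assign x (Num 0) ;; While (Var x) (Var y) (c ;; Assign x (Plus (Var x) (Num 1)))"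

text \<open>Induction on the number \<open>N - i\<close> of remaining rounds. The invariant is read
  at the loop test, hence \<open>step\<close> has to deliver it for the state whose counter has
  already been advanced. The summands 20 cover the test and the increment, and the initialisation
  with the final test.\<close>

lemma run_For:
  assumes "I 0 (s\<lparr>vs := (vs s)(x := 0)\<rparr>)"
    and inv: "\<And>i s. I i s \<Longrightarrow> vs s x = i \<and> vs s y = N"
    and step: "\<And>i s. I i s \<Longrightarrow> i < N \<Longrightarrow>
      run S W c T (\<lambda>s'. vs s' x = i \<and> I (Suc i) (s'\<lparr>vs := (vs s')(x := Suc i)\<rparr>)) s"
    and "N < W" "1 < W" "N * (T + 20) + 20 \<le> T'"
  shows "run S W (For x y c) T' (I N) s"
proof -
  let ?c = "c ;; Assign x (Plus (Var x) (Num 1))"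
  have loop: "run S W (While (Var x) (Var y) ?c) ((N - i) * (T + 20) + 10) (I N) s"
    if "I i s" "i \<le> N" for i s
    using that
  proof (induction "N - i" arbitrary: i s)
    case 0
    then show ?case
      using inv[OF 0(2)] by (intro run_mono[OF run_While_False[where Q = "I N"]]) auto
  next
    case (Suc d)
    then have i: "i < N" by simp
    have body: "run S W ?c (T + 6) (I (Suc i)) s"
    proof (rule run_Seq)
      show "run S W c T (\<lambda>s'. vs s' x = i \<and> I (Suc i) (s'\<lparr>vs := (vs s')(x := Suc i)\<rparr>)) s"
        using step Suc i by blast
      show "run S W (Assign x (Plus (Var x) (Num 1))) 6 (I (Suc i)) s'"
        if "vs s' x = i \<and> I (Suc i) (s'\<lparr>vs := (vs s')(x := Suc i)\<rparr>)" for s'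
        using that i \<open>N < W\<close> \<open>1 < W\<close> by (intro run_mono[OF run_Assign[where Q = "I (Suc i)"]]) auto
    qed simp
    have d: "N - i = Suc (N - Suc i)" using i by simp
    show ?case
    proof (rule run_While_True[OF _ _ _ body])
      show "run S W (While (Var x) (Var y) ?c) ((N - Suc i) * (T + 20) + 10) (I N) s'"
        if "I (Suc i) s'" for s'
        by (rule Suc.hyps(1)) (use Suc.hyps(2) i that in auto)
    qed (use inv[OF Suc.prems(1)] i in \<open>auto simp: d\<close>)
  qed
  have init: "run S W (Assign x (Num 0)) 3 (I 0) s"
    by (rule run_mono[OF run_Assign[where Q = "I 0"]]) (use assms in auto)
  show ?thesis
    unfolding For_def by (rule run_Seq[OF init]) (use loop[of 0] assms(6) in auto)
qed


section \<open>Shortest walks with bounded cost\<close>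

lemma path_edges_append: "path_edges (xs @ y # ys) = path_edges (xs @ [y]) @ path_edges (y # ys)"
  by (induction xs rule: path_edges.induct) auto

lemma path_edges_subset_K_edges: "set p \<subseteq> V \<Longrightarrow> set (path_edges p) \<subseteq> K_edges V"
proof (induction p rule: path_edges.induct)
  case (1 x y xs)
  then show ?case by (cases "x = y") (auto simp: K_edges_def pairs_def)
qed auto

lemma nonedge_cost_append:
  "nonedge_cost E c (xs @ y # ys) = nonedge_cost E c (xs @ [y]) + nonedge_cost E c (y # ys)"
  unfolding nonedge_cost_def by (subst path_edges_append) simp

lemma nonedge_cost_single [simp]: "nonedge_cost E c [x] = 0"
  by (simp add: nonedge_cost_def)

text \<open>The edges that disappear are self-loops, which weigh 0. Together with the inequality for
  costs below, this allows a path in \<open>K\<close> to be compared with walks after its self-loops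
  have been collapsed.\<close>

lemma path_weight_remdups_adj: "path_weight w (remdups_adj p) = path_weight w p"
proof (induction p rule: remdups_adj.induct)
  case (3 x y xs)
  obtain zs where "remdups_adj (y # xs) = y # zs"
    using remdups_adj_Cons_alt by metis
  with 3 show ?case by (auto simp: path_weight_def K_weight_def)
qed auto

lemma nonedge_cost_remdups_adj: "nonedge_cost E c (remdups_adj p) \<le> nonedge_cost E c p"
proof (induction p rule: remdups_adj.induct)
  case (3 x y xs)
  obtain zs where "remdups_adj (y # xs) = y # zs"
    using remdups_adj_Cons_alt by metis
  with 3 show ?case by (auto simp: nonedge_cost_def)
qed auto

lemma le_fold_max: "x \<in> set xs \<or> x \<le> a \<Longrightarrow> (x :: nat) \<le> fold max xs a"
proof (induction xs arbitrary: a)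
  case (Cons y ys)
  then have "x \<in> set ys \<or> x \<le> max y a"
    by (auto simp: le_max_iff_disj)
  from Cons.IH[OF this] show ?case by simp
qed simp

lemma fold_max_le: "(\<And>x. x \<in> set xs \<Longrightarrow> x \<le> m) \<Longrightarrow> a \<le> m \<Longrightarrow> fold max xs (a :: nat) \<le> m"
  by (induction xs arbitrary: a) auto

lemma mem_matrix: "u < n \<Longrightarrow> v < n \<Longrightarrow> f {u, v} \<in> set (matrix n f)"
  by (auto simp: matrix_def intro!: bexI[of _ u] image_eqI[of _ _ v])

locale apbsp =
  fixes n :: nat and E :: "nat set set" and w c :: "nat set \<Rightarrow> nat"
  assumes n: "1 \<le> n"
    and E: "E \<subseteq> pairs {..<n}"
    and c: "\<And>e. e \<in> pairs {..<n} \<Longrightarrow> 1 \<le> c e"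
begin

text \<open>A fold from the left starting at 0, because the setup loop of the program computes the
  maximum in exactly this way.\<close>

definition wmax :: nat where
  "wmax = fold max (matrix n (K_weight w)) 0"

text \<open>A walk that is shortest for these lengths has least weight and, among the walks of least
  weight, the fewest edges. All lengths being positive, it does not repeat a vertex.\<close>

definition len :: "nat \<Rightarrow> nat \<Rightarrow> nat" where
  "len u x = n * K_weight w {u, x} + 1"

text \<open>The sum of \<open>len\<close> over the edges in closed form; it exposes the weight and
  the number of edges, which the final comparison of weights needs separately.\<close>

definition walk_len :: "nat list \<Rightarrow> nat" where
  "walk_len p = n * path_weight w p + (length p - 1)"

definition cost :: "nat \<Rightarrow> nat \<Rightarrow> nat" where
  "cost u x = (if {u, x} \<in> E then 0 else K_cost c {u, x})"

text \<open>A simple walk has fewer than \<open>n\<close> edges, each of length at most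
  \<open>n * wmax + 1\<close>, so this number exceeds every attained distance. It is a number that
  the program can compute and store in a word.\<close>

definition infty :: nat where
  "infty = n * (n * wmax + 1) + 1"

text \<open>Any list of vertices is a walk in \<open>K\<close>, self-loops included. Simplicity is
  left out so that walks can be concatenated; it is regained for shortest walks.\<close>

definition walk :: "nat \<Rightarrow> nat \<Rightarrow> nat \<Rightarrow> nat list \<Rightarrow> bool" where
  "walk \<beta> u v p \<longleftrightarrow>
     p \<noteq> [] \<and> hd p = u \<and> last p = v \<and> set p \<subseteq> {..<n} \<and> nonedge_cost E c p \<le> \<beta>"

definition dist :: "nat \<Rightarrow> nat \<Rightarrow> nat \<Rightarrow> nat" where
  "dist \<beta> u v =
     (if \<exists>p. walk \<beta> u v p then LEAST l. \<exists>p. walk \<beta> u v p \<and> walk_len p = l else infty)"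

section \<open>Walks, their lengths and distances\<close>

lemma cost_pos_iff: "u < n \<Longrightarrow> x < n \<Longrightarrow> 0 < cost u x \<longleftrightarrow> {u, x} \<notin> E"
  using c[of "{u, x}"] by (cases "u = x") (auto simp: cost_def K_cost_def pairs_def)

lemma walk_len_Cons [simp]: "walk_len (u # x # p) = len u x + walk_len (x # p)"
  by (simp add: walk_len_def len_def path_weight_def algebra_simps)

lemma walk_len_single [simp]: "walk_len [x] = 0"
  by (simp add: walk_len_def path_weight_def)

lemma nonedge_cost_Cons [simp]:
  "nonedge_cost E c (u # x # p) = cost u x + nonedge_cost E c (x # p)"
  by (simp add: nonedge_cost_def cost_def)

lemma walk_len_append: "walk_len (xs @ y # ys) = walk_len (xs @ [y]) + walk_len (y # ys)"
  by (simp add: walk_len_def path_weight_def path_edges_append[of xs y ys] algebra_simps)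

lemma walk_singleI: "u < n \<Longrightarrow> walk \<beta> u u [u]"
  by (simp add: walk_def)

lemma walk_Cons_iff:
  "walk \<beta> u v (u # x # p) \<longleftrightarrow> u < n \<and> cost u x \<le> \<beta> \<and> walk (\<beta> - cost u x) x v (x # p)"
  by (auto simp: walk_def)

text \<open>The first walk has budget 0, so the concatenation costs no more than the second walk is
  allowed to.\<close>

lemma walk_append:
  assumes "walk 0 u k p" "walk \<beta> k v q"
  obtains r where "walk \<beta> u v r" "walk_len r = walk_len p + walk_len q"
proof -
  obtain xs where p: "p = xs @ [k]"
    using assms(1) unfolding walk_def by (metis append_butlast_last_id)
  obtain ys where q: "q = k # ys"
    using assms(2) unfolding walk_def by (metis list.collapse)
  have "walk \<beta> u v (xs @ k # ys)"
    using assms nonedge_cost_append[of E c xs k ys] unfolding p q walk_def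
    by (auto simp: hd_append)
  then show ?thesis
    using that walk_len_append[of xs k ys] p q by simp
qed

lemma dist_le_walk_len: "walk \<beta> u v p \<Longrightarrow> dist \<beta> u v \<le> walk_len p"
  unfolding dist_def by (auto intro: Least_le)

lemma shortest_walk:
  assumes "walk \<beta> u v p"
  obtains q where "walk \<beta> u v q" "walk_len q = dist \<beta> u v"
proof -
  have "\<exists>q. walk \<beta> u v q \<and> walk_len q = (LEAST l. \<exists>p. walk \<beta> u v p \<and> walk_len p = l)"
    by (rule LeastI[of _ "walk_len p"]) (use assms in blast)
  moreover have "dist \<beta> u v = (LEAST l. \<exists>p. walk \<beta> u v p \<and> walk_len p = l)"
    using assms by (auto simp: dist_def)
  ultimately show ?thesis
    using that by metis
qed

text \<open>Between two visits of the same vertex lies a closed walk with at least one edge. Cutting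
  it out saves a positive length and cannot raise the cost.\<close>

lemma shortest_walk_distinct:
  assumes p: "walk \<beta> u v p" "walk_len p = dist \<beta> u v"
  shows "distinct p"
proof (rule ccontr)
  assume "\<not> distinct p"
  then obtain xs ys zs y where eq: "p = xs @ [y] @ ys @ [y] @ zs"
    by (blast dest: not_distinct_decomp)
  have "walk_len (y # ys @ y # zs) = walk_len (y # ys @ [y]) + walk_len (y # zs)"
    using walk_len_append[of "y # ys" y zs] by simp
  moreover have "walk_len (y # ys @ [y]) > 0"
    by (simp add: walk_len_def)
  ultimately have "walk_len (xs @ y # zs) < walk_len p"
    using walk_len_append[of xs y zs] walk_len_append[of xs y "ys @ y # zs"] eq by simp
  moreover have "walk \<beta> u v (xs @ y # zs)"
    using p(1) nonedge_cost_append[of E c xs y zs] nonedge_cost_append[of E c xs y "ys @ y # zs"]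
      nonedge_cost_append[of E c "y # ys" y zs]
    unfolding eq walk_def by (auto simp: hd_append)
  ultimately show False
    using dist_le_walk_len p(2) by fastforce
qed

lemma K_weight_le_wmax: "u < n \<Longrightarrow> x < n \<Longrightarrow> K_weight w {u, x} \<le> wmax"
  unfolding wmax_def by (intro le_fold_max disjI1 mem_matrix)

lemma distinct_length_le:
  assumes "distinct p" "set p \<subseteq> {..<n}"
  shows "length p \<le> n"
  using assms by (metis card_lessThan card_mono distinct_card finite_lessThan)

lemma walk_len_le:
  assumes "set p \<subseteq> {..<n}"
  shows "walk_len p \<le> (length p - 1) * (n * wmax + 1)"
  using assms
proof (induction p rule: path_edges.induct)
  case (1 x y xs)
  then have "len x y \<le> n * wmax + 1"
    using K_weight_le_wmax[of x y] by (simp add: len_def)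
  moreover have "walk_len (y # xs) \<le> length xs * (n * wmax + 1)"
    using 1 by simp
  ultimately show ?case by simp
qed (auto simp: walk_len_def path_weight_def)

text \<open>A shortest walk is simple, hence has at most \<open>n\<close> vertices, and
  \<open>infty\<close> was chosen just above the resulting bound. So the comparison with
  \<open>infty\<close> in the program decides reachability.\<close>

lemma dist_less_infty_iff: "dist \<beta> u v < infty \<longleftrightarrow> (\<exists>p. walk \<beta> u v p)"
proof
  assume "\<exists>p. walk \<beta> u v p"
  then obtain p where p: "walk \<beta> u v p" "walk_len p = dist \<beta> u v"
    using shortest_walk by blast
  have "length p \<le> n"
    using distinct_length_le shortest_walk_distinct p unfolding walk_def by blast
  have "walk_len p \<le> (length p - 1) * (n * wmax + 1)"
    using walk_len_le p unfolding walk_def by blast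
  also have "\<dots> \<le> n * (n * wmax + 1)"
    using \<open>length p \<le> n\<close> by (intro mult_right_mono) auto
  finally show "dist \<beta> u v < infty"
    using p by (simp add: infty_def)
qed (auto simp: dist_def split: if_splits)

lemma dist_le_infty: "dist \<beta> u v \<le> infty"
  by (metis dist_def dist_less_infty_iff order_less_imp_le order_refl)

lemma dist_refl: "u < n \<Longrightarrow> dist \<beta> u u = 0"
  using dist_le_walk_len[OF walk_singleI] by simp

lemma len_le_infty:
  assumes "u < n" "x < n"
  shows "len u x \<le> infty"
proof -
  have "n * K_weight w {u, x} + 1 \<le> 1 * (n * wmax + 1)"
    using K_weight_le_wmax[OF assms] by simp
  also have "\<dots> \<le> n * (n * wmax + 1)"
    using n by (intro mult_right_mono) auto
  finally show ?thesis
    by (simp add: len_def infty_def)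
qed

text \<open>Prepend \<open>u\<close> to a shortest walk from \<open>x\<close>. If there is none, the
  right-hand side contains the sentinel, which is at least every distance.\<close>

lemma dist_le_step:
  assumes "u < n" "cost u x \<le> \<beta>"
  shows "dist \<beta> u v \<le> len u x + dist (\<beta> - cost u x) x v"
proof (cases "\<exists>p. walk (\<beta> - cost u x) x v p")
  case True
  then obtain p where p: "walk (\<beta> - cost u x) x v p" "walk_len p = dist (\<beta> - cost u x) x v"
    using shortest_walk by blast
  obtain q where "p = x # q"
    using p unfolding walk_def by (metis list.collapse)
  with p assms show ?thesis
    using dist_le_walk_len[of \<beta> u v "u # p"] by (simp add: walk_Cons_iff)
next
  case False
  then show ?thesis
    using dist_le_infty[of \<beta> u v] by (simp add: dist_def)
qed

text \<open>The first step of a shortest walk is tight, since a shorter continuation would shorten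
  the whole walk. This is the source of the stored next vertices.\<close>

lemma dist_eq_step:
  assumes "dist \<beta> u v < infty" "u \<noteq> v"
  obtains x where "x < n" "cost u x \<le> \<beta>" "dist \<beta> u v = len u x + dist (\<beta> - cost u x) x v"
proof -
  obtain p where p: "walk \<beta> u v p" "walk_len p = dist \<beta> u v"
    using assms(1) dist_less_infty_iff shortest_walk by blast
  then obtain x q where q: "p = u # x # q"
    using assms(2) unfolding walk_def by (metis last_ConsL list.collapse)
  have x: "x < n" "u < n" "cost u x \<le> \<beta>" "walk (\<beta> - cost u x) x v (x # q)"
    using p unfolding q by (auto simp: walk_Cons_iff walk_def)
  have "dist \<beta> u v = len u x + dist (\<beta> - cost u x) x v"
    using dist_le_walk_len[OF x(4)] dist_le_step[OF x(2,3)] p(2) unfolding q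
    by (intro antisym) auto
  with x that show ?thesis by blast
qed

text \<open>The first leg consumes nothing of the budget. This inequality is what keeps every
  relaxation in the closing phase above the true distance.\<close>

lemma dist_triangle: "dist \<beta> u v \<le> dist 0 u k + dist \<beta> k v"
proof (cases "(\<exists>p. walk 0 u k p) \<and> (\<exists>q. walk \<beta> k v q)")
  case True
  then obtain p q where "walk 0 u k p" "walk_len p = dist 0 u k" "walk \<beta> k v q" "walk_len q = dist \<beta> k v"
    using shortest_walk by metis
  then show ?thesis
    using dist_le_walk_len by (metis walk_append)
next
  case False
  then have "dist 0 u k = infty \<or> dist \<beta> k v = infty"
    by (auto simp: dist_def)
  then show ?thesis
    using dist_le_infty[of \<beta> u v] by linarith
qed

text \<open>A non-edge has positive cost, so the last condition only involves lower layers.\<close>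

definition initial :: "nat \<Rightarrow> nat \<Rightarrow> nat \<Rightarrow> nat \<Rightarrow> bool" where
  "initial \<beta> u v y \<longleftrightarrow> dist \<beta> u v \<le> y \<and> y \<le> infty \<and> (u = v \<longrightarrow> y = 0)
     \<and> ({u, v} \<in> E \<longrightarrow> y \<le> len u v)
     \<and> (\<forall>x<n. 0 < cost u x \<longrightarrow> cost u x \<le> \<beta> \<longrightarrow> y \<le> len u x + dist (\<beta> - cost u x) x v)"

text \<open>The vertex \<open>y\<close> is the place where a shortest walk stops following edges of
  \<open>G\<close>: up to \<open>y\<close> it is measured by \<open>dist 0\<close>, and from
  \<open>y\<close> on it is covered by \<open>M y\<close>. It is found by induction on the distance,
  which drops with every step because lengths are positive.\<close>

lemma layer_le_dist:
  assumes D: "\<And>u y. u < n \<Longrightarrow> y < n \<Longrightarrow> D u \<le> dist 0 u y + M y"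
    and M: "\<And>y. y < n \<Longrightarrow> initial \<beta> y v (M y)"
    and "u < n" "v < n"
  shows "D u \<le> dist \<beta> u v"
proof -
  have M_le: "M y \<le> infty" if "y < n" for y
    using M[OF that] by (simp add: initial_def)
  have "\<exists>y<n. dist 0 u y + M y \<le> dist \<beta> u v"
    using \<open>u < n\<close>
  proof (induction "dist \<beta> u v" arbitrary: u rule: less_induct)
    case less
    show ?case
    proof (cases "u = v \<or> dist \<beta> u v = infty")
      case True
      \<comment> \<open>The free part is empty. If \<open>u = v\<close> then \<open>M u\<close> is
        0; otherwise the distance is the sentinel, which bounds \<open>M u\<close>.\<close>
      then show ?thesis
        using M[OF \<open>u < n\<close>] M_le[OF \<open>u < n\<close>] dist_refl[OF \<open>u < n\<close>] less.prems
        by (intro exI[of _ u]) (auto simp: initial_def)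
    next
      case False
      then obtain x where x: "x < n" "cost u x \<le> \<beta>"
        "dist \<beta> u v = len u x + dist (\<beta> - cost u x) x v"
        using dist_eq_step dist_le_infty by (metis le_neq_implies_less)
      show ?thesis
      proof (cases "cost u x = 0")
        case True
        then have "dist \<beta> x v < dist \<beta> u v"
          using x by (simp add: len_def)
        from less.hyps[OF this x(1)] obtain y where y: "y < n" "dist 0 x y + M y \<le> dist \<beta> x v"
          by blast
        have "dist 0 u y \<le> len u x + dist 0 x y"
          using dist_le_step[of u x 0 y] True less.prems by simp
        with y x True show ?thesis by (intro exI[of _ y]) auto
      next
        case False
        \<comment> \<open>The walk starts with a non-edge, a case that the last conjunct of
          \<open>initial\<close> accounts for.\<close>
        then have "M u \<le> dist \<beta> u v"
          using M[OF \<open>u < n\<close>] x by (auto simp: initial_def)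
        then show ?thesis
          using less.prems dist_refl by (intro exI[of _ u]) auto
      qed
    qed
  qed
  then show ?thesis
    using D[OF \<open>u < n\<close>] order_trans by blast
qed

text \<open>The classical invariant on inner vertices below \<open>k\<close>, restricted to edges of
  \<open>G\<close> and kept as an upper bound only: updates in place may already have made an entry
  smaller than the optimum of stage \<open>k\<close>.\<close>

definition floyd_warshall :: "nat \<Rightarrow> (nat \<Rightarrow> nat \<Rightarrow> nat) \<Rightarrow> bool" where
  "floyd_warshall k D \<longleftrightarrow> (\<forall>u<n. \<forall>v<n. \<forall>q. set q \<subseteq> {..<k} \<longrightarrow>
     set (path_edges (u # q @ [v])) \<subseteq> E \<longrightarrow> D u v \<le> walk_len (u # q @ [v]))"

lemma floyd_warshall_0:
  assumes "\<And>u v. u < n \<Longrightarrow> v < n \<Longrightarrow> initial 0 u v (D u v)"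
  shows "floyd_warshall 0 D"
  using assms by (auto simp: floyd_warshall_def initial_def)

text \<open>A walk through \<open>k\<close> is cut at the first and at the last occurrence of
  \<open>k\<close>. Both outer parts avoid \<open>k\<close> inside, so \<open>D\<close> bounds them,
  and the closed middle part only adds length. Walks that pass \<open>k\<close> repeatedly are
  thereby covered.\<close>

lemma floyd_warshall_Suc:
  assumes D: "floyd_warshall k D" and k: "k < n"
    and le: "\<And>u v. u < n \<Longrightarrow> v < n \<Longrightarrow> D' u v \<le> D u v"
    and via: "\<And>u v. u < n \<Longrightarrow> v < n \<Longrightarrow> D' u v \<le> D u k + D k v"
  shows "floyd_warshall (Suc k) D'"
  unfolding floyd_warshall_def
proof (intro allI impI)
  fix u v q
  assume uv: "u < n" "v < n" and q: "set q \<subseteq> {..<Suc k}"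
    and qE: "set (path_edges (u # q @ [v])) \<subseteq> E"
  have D: "D u v \<le> walk_len (u # q @ [v])"
    if "u < n" "v < n" "set q \<subseteq> {..<k}" "set (path_edges (u # q @ [v])) \<subseteq> E" for u v q
    using D that unfolding floyd_warshall_def by blast
  show "D' u v \<le> walk_len (u # q @ [v])"
  proof (cases "k \<in> set q")
    case False
    with q have "set q \<subseteq> {..<k}"
      by (auto simp: less_Suc_eq)
    from D[OF uv this qE] le[OF uv] show ?thesis by simp
  next
    case True
    then obtain q1 r where 1: "q = q1 @ k # r" "k \<notin> set q1"
      by (meson split_list_first)
    \<comment> \<open>With \<open>k\<close> put back in front, a last occurrence exists even if
      \<open>r\<close> avoids \<open>k\<close>; \<open>r1\<close> is the part that will be
      dropped.\<close>
    obtain r1 q2 where 2: "k # r = r1 @ k # q2" "k \<notin> set q2"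
      using split_list_last[of k "k # r"] by auto
    have q12: "set q1 \<subseteq> {..<k}" "set q2 \<subseteq> {..<k}"
      using q 1 2 arg_cong[OF 2(1), of set] by (auto simp: less_Suc_eq)
    have eq1: "u # q @ [v] = (u # q1) @ k # r @ [v]"
      using 1 by simp
    have eq2: "k # r @ [v] = r1 @ k # q2 @ [v]"
      using 2 by (metis append_Cons append_assoc)
    have E1: "set (path_edges (u # q1 @ [k])) \<subseteq> E" "set (path_edges (k # r @ [v])) \<subseteq> E"
      using qE path_edges_append[of "u # q1" k "r @ [v]"] unfolding eq1 by auto
    have E2: "set (path_edges (k # q2 @ [v])) \<subseteq> E"
      using E1(2) path_edges_append[of "r1" k "q2 @ [v]"] unfolding eq2 by auto
    have "D' u v \<le> D u k + D k v"
      by (rule via[OF uv])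
    also have "\<dots> \<le> walk_len (u # q1 @ [k]) + walk_len (k # q2 @ [v])"
      using D[OF uv(1) k q12(1) E1(1)] D[OF k uv(2) q12(2) E2] by simp
    also have "walk_len (k # q2 @ [v]) \<le> walk_len (k # r @ [v])"
      unfolding eq2 using walk_len_append[of r1 k "q2 @ [v]"] by simp
    also have "walk_len (u # q1 @ [k]) + walk_len (k # r @ [v]) = walk_len (u # q @ [v])"
      unfolding eq1 using walk_len_append[of "u # q1" k "r @ [v]"] by simp
    finally show ?thesis by simp
  qed
qed

lemma cost_0_imp_edges:
  "nonedge_cost E c p = 0 \<Longrightarrow> set p \<subseteq> {..<n} \<Longrightarrow> set (path_edges p) \<subseteq> E"
proof (induction p rule: path_edges.induct)
  case (1 x y xs)
  then show ?case using cost_pos_iff[of x y] by auto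
qed auto

lemma floyd_warshall_le_dist:
  assumes D: "floyd_warshall n D" and "u < n" "v < n" "u = v \<Longrightarrow> D u v = 0" "D u v \<le> infty"
  shows "D u v \<le> dist 0 u v"
proof (cases "u = v \<or> dist 0 u v = infty")
  case False
  then obtain p where p: "walk 0 u v p" "walk_len p = dist 0 u v"
    using dist_less_infty_iff dist_le_infty shortest_walk by (metis le_neq_implies_less)
  then obtain q where q: "p = u # q @ [v]"
    using False unfolding walk_def
    by (metis append_butlast_last_id append_Cons append_Nil last_ConsL list.collapse list.sel(1) neq_Nil_conv)
  have "set (path_edges p) \<subseteq> E" "set q \<subseteq> {..<n}"
    using p cost_0_imp_edges[of p] unfolding walk_def q by auto
  then have "D u v \<le> walk_len p"
    using D assms unfolding floyd_warshall_def q by blast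
  then show ?thesis using p by simp
qed (use assms in auto)

section \<open>Shortest walks as minimum-weight paths\<close>

lemma bounded_cost_path_imp_walk:
  assumes "bounded_cost_path {..<n} E c \<beta> u v p"
  shows "walk \<beta> u v (remdups_adj p)" "distinct (remdups_adj p)"
  using assms nonedge_cost_remdups_adj[of E c p]
  by (auto simp: bounded_cost_path_def K_path_def walk_def hd_remdups_adj last_remdups_adj)

lemma distinct_walk_imp_bounded_cost_path:
  assumes "walk \<beta> u v p" "distinct p"
  shows "bounded_cost_path {..<n} E c \<beta> u v p"
proof -
  have "remdups_adj p = p"
    using assms(2) by (rule remdups_adj_distinct)
  then show ?thesis
    using assms path_edges_subset_K_edges[of p "{..<n}"]
    by (auto simp: bounded_cost_path_def K_path_def walk_def)
qed

text \<open>A competing path with its self-loops collapsed has at most \<open>n - 1\<close> edges,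
  so its length is below \<open>n\<close> times its weight plus one. Comparing lengths and
  cancelling \<open>n\<close> therefore compares the weights.\<close>

lemma shortest_walk_min_weight_path:
  assumes p: "walk \<beta> u v p" "walk_len p = dist \<beta> u v"
  shows "min_weight_path {..<n} E w c \<beta> u v p"
  unfolding min_weight_path_def is_arg_min_linorder
proof (intro conjI allI impI)
  show "bounded_cost_path {..<n} E c \<beta> u v p"
    using distinct_walk_imp_bounded_cost_path shortest_walk_distinct p by blast
next
  fix q
  assume q: "bounded_cost_path {..<n} E c \<beta> u v q"
  let ?q = "remdups_adj q"
  have "length ?q \<le> n"
    using bounded_cost_path_imp_walk[OF q] distinct_length_le unfolding walk_def by blast
  then have "walk_len ?q < n * path_weight w q + n"
    using n by (simp add: walk_len_def path_weight_remdups_adj)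
  moreover have "walk_len p \<le> walk_len ?q"
    using p dist_le_walk_len[OF bounded_cost_path_imp_walk(1)[OF q]] by simp
  ultimately have "n * path_weight w p < n * (path_weight w q + 1)"
    by (simp add: walk_len_def)
  then show "path_weight w p \<le> path_weight w q"
    using mult_less_cancel1[of n] by (metis less_Suc_eq_le Suc_eq_plus1)
qed

lemma ex_bounded_cost_path_iff:
  "(\<exists>p. bounded_cost_path {..<n} E c \<beta> u v p) \<longleftrightarrow> dist \<beta> u v < infty"
proof
  assume "dist \<beta> u v < infty"
  then obtain p where "walk \<beta> u v p" "walk_len p = dist \<beta> u v"
    using dist_less_infty_iff shortest_walk by blast
  then show "\<exists>p. bounded_cost_path {..<n} E c \<beta> u v p"
    using distinct_walk_imp_bounded_cost_path shortest_walk_distinct by blast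
next
  assume "\<exists>p. bounded_cost_path {..<n} E c \<beta> u v p"
  then show "dist \<beta> u v < infty"
    using bounded_cost_path_imp_walk(1) dist_less_infty_iff by blast
qed

end


section \<open>The program and its memory\<close>

lemma run_wp: "wp S W c Q s \<Longrightarrow> 2 * csize c \<le> T \<Longrightarrow> run S W c T Q s"
  by (rule run_mono[OF wp_run])

text \<open>Because of \<open>1 \<le> N\<close> the constant overhead of a loop is absorbed into the
  cost per round, and bounds for nested loops become plain products.\<close>

lemma run_For':
  assumes "I 0 (s\<lparr>vs := (vs s)(x := 0)\<rparr>)"
    and "\<And>i s. I i s \<Longrightarrow> vs s x = i \<and> vs s y = N"
    and "\<And>i s. I i s \<Longrightarrow> i < N \<Longrightarrow>
      run S W c T (\<lambda>s'. vs s' x = i \<and> I (Suc i) (s'\<lparr>vs := (vs s')(x := Suc i)\<rparr>)) s"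
    and "1 \<le> N" "N < W" "1 < W"
    and "\<And>s. I N s \<Longrightarrow> Q s"
  shows "run S W (For x y c) (N * (T + 40)) Q s"
proof (rule run_mono[OF run_For[of I s x y N S W c T]])
  show "N * (T + 20) + 20 \<le> N * (T + 40)"
    using \<open>1 \<le> N\<close> by (simp add: algebra_simps)
qed (use assms in blast)+

lemmas run_Seq' = run_Seq[OF _ _ order_refl]

text \<open>Variables 2 to 7 are fixed during the setup; those from 8 on are counters and working
  variables. The invariant \<open>frame\<close> relies on this split.\<close>

abbreviation (input) "r_n \<equiv> 2 :: nat"
abbreviation (input) "r_nn \<equiv> 3 :: nat"
abbreviation (input) "r_B \<equiv> 4 :: nat"
abbreviation (input) "r_infty \<equiv> 5 :: nat"
abbreviation (input) "r_dist \<equiv> 6 :: nat"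
abbreviation (input) "r_next \<equiv> 7 :: nat"
abbreviation (input) "r_b \<equiv> 8 :: nat"
abbreviation (input) "r_u \<equiv> 9 :: nat"
abbreviation (input) "r_v \<equiv> 10 :: nat"
abbreviation (input) "r_x \<equiv> 11 :: nat"
abbreviation (input) "r_k \<equiv> 12 :: nat"
abbreviation (input) "r_acc \<equiv> 13 :: nat"
abbreviation (input) "r_cost \<equiv> 14 :: nat"
abbreviation (input) "r_cand \<equiv> 15 :: nat"
abbreviation (input) "r_pos \<equiv> 16 :: nat"
abbreviation (input) "r_rest \<equiv> 17 :: nat"
abbreviation (input) "r_len \<equiv> 18 :: nat"

definition e_index :: "exp \<Rightarrow> exp \<Rightarrow> exp" where
  "e_index p q = Plus (Times p (Var r_n)) q"

text \<open>The offsets here and in the next two expressions mirror the input: two header cells,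
  then the adjacency, weight and cost matrices of \<open>n * n\<close> cells each.\<close>

definition e_adj :: "exp \<Rightarrow> exp \<Rightarrow> exp" where
  "e_adj p q = Ld (Plus (Num 2) (e_index p q))"

definition e_len :: "exp \<Rightarrow> exp \<Rightarrow> exp" where
  "e_len p q = Plus (Times (Var r_n) (Ld (Plus (Plus (Num 2) (Var r_nn)) (e_index p q)))) (Num 1)"

definition e_cost :: "exp \<Rightarrow> exp \<Rightarrow> exp" where
  "e_cost p q = Ld (Plus (Plus (Num 2) (Plus (Var r_nn) (Var r_nn))) (e_index p q))"

definition a_dist :: "exp \<Rightarrow> exp \<Rightarrow> exp \<Rightarrow> exp" where
  "a_dist b p q = Plus (Var r_dist) (e_index (e_index b p) q)"

definition a_next :: "exp \<Rightarrow> exp \<Rightarrow> exp \<Rightarrow> exp" where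
  "a_next b p q = Plus (Var r_next) (e_index (e_index b p) q)"

text \<open>The absolute difference, by truncated subtraction. Tests can only compare with
  \<open><\<close>, and this value is positive exactly if the operands differ.\<close>

definition e_diff :: "exp \<Rightarrow> exp \<Rightarrow> exp" where
  "e_diff p q = Plus (Minus p q) (Minus q p)"

lemma esize_simps [simp]:
  "esize (e_index p q) = esize p + esize q + 4"
  "esize (e_adj p q) = esize p + esize q + 7"
  "esize (e_len p q) = esize p + esize q + 15"
  "esize (e_cost p q) = esize p + esize q + 13"
  "esize (a_dist b p q) = esize b + esize p + esize q + 11"
  "esize (a_next b p q) = esize b + esize p + esize q + 11"
  "esize (e_diff p q) = 2 * esize p + 2 * esize q + 3"
  by (simp_all add: e_index_def e_adj_def e_len_def e_cost_def a_dist_def a_next_def e_diff_def)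

definition skip :: com where
  "skip = Assign r_cand (Var r_cand)"

definition get_cost :: "exp \<Rightarrow> exp \<Rightarrow> com" where
  "get_cost p q = If (Num 0) (e_adj p q) (Assign r_cost (Num 0)) (Assign r_cost (e_cost p q))"

lemma csize_simps [simp]:
  "csize skip = 4"
  "csize (get_cost p q) = 2 * esize p + 2 * esize q + 28"
  by (simp_all add: skip_def get_cost_def)

definition init_step :: com where
  "init_step =
     get_cost (Var r_u) (Var r_x) ;;
     If (Num 0) (Var r_cost)
       (If (Var r_cost) (Plus (Var r_b) (Num 1))
         (Assign r_cand (Plus (e_len (Var r_u) (Var r_x))
            (Ld (a_dist (Minus (Var r_b) (Var r_cost)) (Var r_x) (Var r_v)))) ;;
          If (Var r_cand) (Var r_acc) (Assign r_acc (Var r_cand)) skip)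
         skip)
       skip"

definition init_start :: com where
  "init_start =
     If (Num 0) (e_adj (Var r_u) (Var r_v))
       (Assign r_acc (e_len (Var r_u) (Var r_v))) (Assign r_acc (Var r_infty)) ;;
     If (e_diff (Var r_u) (Var r_v)) (Num 1) (Assign r_acc (Num 0)) skip"

definition init_phase :: com where
  "init_phase = For r_u r_n (For r_v r_n
     (init_start ;; For r_x r_n init_step ;;
      Sto (a_dist (Var r_b) (Var r_u) (Var r_v)) (Var r_acc)))"

text \<open>The left summand is always read from layer 0. For \<open>b = 0\<close> this is the
  matrix being updated, so the same loops serve both as Floyd--Warshall and as a product with a
  finished matrix.\<close>

definition close_phase :: com where
  "close_phase = For r_k r_n (For r_u r_n (For r_v r_n
     (Assign r_cand (Plus (Ld (a_dist (Num 0) (Var r_u) (Var r_k)))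
        (Ld (a_dist (Var r_b) (Var r_k) (Var r_v)))) ;;
      If (Var r_cand) (Ld (a_dist (Var r_b) (Var r_u) (Var r_v)))
        (Sto (a_dist (Var r_b) (Var r_u) (Var r_v)) (Var r_cand)) skip)))"

text \<open>Steps of cost 0 are allowed here because layer \<open>b\<close> is finished by now. A
  candidate is never below the distance, so \<open>cand < dist + 1\<close> is a test for
  equality.\<close>

definition next_step :: com where
  "next_step =
     get_cost (Var r_u) (Var r_x) ;;
     If (Var r_cost) (Plus (Var r_b) (Num 1))
       (Assign r_cand (Plus (e_len (Var r_u) (Var r_x))
          (Ld (a_dist (Minus (Var r_b) (Var r_cost)) (Var r_x) (Var r_v)))) ;;
        If (Var r_cand) (Plus (Ld (a_dist (Var r_b) (Var r_u) (Var r_v))) (Num 1))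
          (Assign r_acc (Var r_x)) skip)
       skip"

definition next_phase :: com where
  "next_phase = For r_u r_n (For r_v r_n
     (Assign r_acc (Num 0) ;; For r_x r_n next_step ;;
      Sto (a_next (Var r_b) (Var r_u) (Var r_v)) (Var r_acc)))"

definition start :: com where
  "start = Assign r_pos (Var r_u) ;; Assign r_rest (Var r_b)"

definition move :: com where
  "move =
     Assign r_x (Ld (a_next (Var r_rest) (Var r_pos) (Var r_v))) ;;
     get_cost (Var r_pos) (Var r_x) ;;
     Assign r_rest (Minus (Var r_rest) (Var r_cost)) ;; Assign r_pos (Var r_x)"

text \<open>The number of vertices has to be written before the vertices, and output cannot be
  revised; so this loop follows the route once just to count.\<close>

definition count_loop :: com where
  "count_loop = While (Num 0) (e_diff (Var r_pos) (Var r_v))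
     (move ;; Assign r_len (Plus (Var r_len) (Num 1)))"

definition write_loop :: com where
  "write_loop = While (Num 0) (e_diff (Var r_pos) (Var r_v)) (Out (Var r_pos) ;; move)"

definition print_phase :: com where
  "print_phase = For r_u r_n (For r_v r_n
     (If (Ld (a_dist (Var r_b) (Var r_u) (Var r_v))) (Var r_infty)
       ((start ;; Assign r_len (Num 1)) ;; count_loop ;; (Out (Var r_len) ;; start)
        ;; write_loop ;; Out (Var r_v))
       (Out (Num 0))))"

text \<open>\<open>r_B\<close> holds \<open>B + 1\<close>, the number of layers, as the bound of the
  outermost loop. The sentinel is set only after the largest weight has been found.\<close>

definition setup1 :: com where
  "setup1 =
     Assign r_n (Ld (Num 0)) ;; Assign r_nn (Times (Var r_n) (Var r_n)) ;;
     Assign r_B (Plus (Ld (Num 1)) (Num 1)) ;;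
     Assign r_dist (Plus (Num 2) (Times (Num 3) (Var r_nn))) ;;
     Assign r_next (Plus (Var r_dist) (Times (Var r_B) (Var r_nn))) ;;
     Assign r_acc (Num 0)"

definition max_step :: com where
  "max_step =
     Assign r_cand (Ld (Plus (Plus (Num 2) (Var r_nn)) (Var r_x))) ;;
     If (Var r_acc) (Var r_cand) (Assign r_acc (Var r_cand)) skip"

definition setup2 :: com where
  "setup2 = Assign r_infty
     (Plus (Times (Var r_n) (Plus (Times (Var r_n) (Var r_acc)) (Num 1))) (Num 1))"

definition main :: com where
  "main = setup1 ;; For r_x r_nn max_step ;; setup2 ;;
     For r_b r_B (init_phase ;; close_phase ;; next_phase ;; print_phase)"

section \<open>Row-major matrices\<close>

lemma concat_blocks_length: "length (concat (map (\<lambda>u. map (g u) [0..<n]) [0..<k])) = k * n"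
  by (induction k) auto

lemma concat_blocks_nth:
  "u < k \<Longrightarrow> v < n \<Longrightarrow> concat (map (\<lambda>u. map (g u) [0..<n]) [0..<k]) ! (u * n + v) = g u v"
proof (induction k)
  case (Suc k)
  show ?case
  proof (cases "u = k")
    case True
    with Suc.prems show ?thesis
      by (simp add: nth_append concat_blocks_length)
  next
    case False
    then have "(u + 1) * n \<le> k * n"
      using Suc.prems by (intro mult_right_mono) auto
    with Suc False show ?thesis
      by (simp add: nth_append concat_blocks_length)
  qed
qed simp

lemma matrix_eq: "matrix n f = concat (map (\<lambda>u. map (\<lambda>v. f {u, v}) [0..<n]) [0..<n])"
  by (simp add: matrix_def)

lemma length_matrix [simp]: "length (matrix n f) = n * n"
  by (simp add: matrix_eq concat_blocks_length)

lemma nth_matrix: "u < n \<Longrightarrow> v < n \<Longrightarrow> matrix n f ! (u * n + v) = f {u, v}"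
  unfolding matrix_eq by (rule concat_blocks_nth)

locale apbsp_ram = apbsp +
  fixes B :: nat
begin

definition inp :: "nat list" where "inp = apbsp_input n E w c B"
definition W :: nat where "W = word_bound 8 inp"
text \<open>The memory holds the input, then from \<open>dbase\<close> on the distances and from \<open>xbase\<close> on the
  next vertices.\<close>

definition dbase :: nat where "dbase = 2 + 3 * (n * n)"
definition xbase :: nat where "xbase = dbase + Suc B * (n * n)"
definition S :: nat where "S = xbase + Suc B * (n * n)"

definition idx :: "nat \<Rightarrow> nat \<Rightarrow> nat \<Rightarrow> nat" where
  "idx \<beta> u v = (\<beta> * n + u) * n + v"

section \<open>Addresses, input cells and the word size\<close>

lemma index_less: "u < k \<Longrightarrow> v < n \<Longrightarrow> u * n + v < k * n"
  by (metis add.commute add_less_mono1 less_le_trans mult_Suc mult_le_mono1 Suc_leI)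

lemma index_eq_iff:
  assumes "v < n" "v' < n"
  shows "u * n + v = u' * n + v' \<longleftrightarrow> u = u' \<and> v = v'"
proof
  assume eq: "u * n + v = u' * n + v'"
  then have "(u * n + v) div n = (u' * n + v') div n" by simp
  then have "u = u'" using assms by simp
  with eq show "u = u' \<and> v = v'" by simp
qed simp

lemma idx_eq_iff [simp]:
  "u < n \<Longrightarrow> v < n \<Longrightarrow> u' < n \<Longrightarrow> v' < n \<Longrightarrow>
     idx \<beta> u v = idx \<beta>' u' v' \<longleftrightarrow> \<beta> = \<beta>' \<and> u = u' \<and> v = v'"
  by (auto simp: idx_def index_eq_iff)

lemma idx_less: "\<beta> \<le> B \<Longrightarrow> u < n \<Longrightarrow> v < n \<Longrightarrow> idx \<beta> u v < Suc B * (n * n)"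
  unfolding idx_def mult.assoc[symmetric] by (intro index_less) auto

lemma dist_next_disjoint [simp]:
  "\<beta> \<le> B \<Longrightarrow> u < n \<Longrightarrow> v < n \<Longrightarrow> dbase + idx \<beta> u v \<noteq> xbase + a"
  "\<beta> \<le> B \<Longrightarrow> u < n \<Longrightarrow> v < n \<Longrightarrow> xbase + a \<noteq> dbase + idx \<beta> u v"
  using idx_less[of \<beta> u v] by (auto simp: xbase_def)

lemma address_less_S [simp]:
  "\<beta> \<le> B \<Longrightarrow> u < n \<Longrightarrow> v < n \<Longrightarrow> dbase + idx \<beta> u v < S"
  "\<beta> \<le> B \<Longrightarrow> u < n \<Longrightarrow> v < n \<Longrightarrow> xbase + idx \<beta> u v < S"
  using idx_less[of \<beta> u v] by (auto simp: S_def xbase_def)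

lemma length_inp: "length inp = dbase"
  by (simp add: inp_def apbsp_input_def dbase_def)

lemma inp_0: "inp ! 0 = n" and inp_1: "inp ! 1 = B"
  by (simp_all add: inp_def apbsp_input_def)

lemma inp_adj:
  assumes "u < n" "v < n"
  shows "inp ! (2 + (u * n + v)) = of_bool ({u, v} \<in> E)"
  using index_less[OF assms] nth_matrix[OF assms]
  by (simp add: inp_def apbsp_input_def nth_append)

lemma inp_weight': "i < n * n \<Longrightarrow> inp ! (2 + n * n + i) = matrix n (K_weight w) ! i"
  by (simp add: inp_def apbsp_input_def nth_append)

lemma inp_weight:
  assumes "u < n" "v < n"
  shows "inp ! (2 + n * n + (u * n + v)) = K_weight w {u, v}"
  using inp_weight' index_less[OF assms] nth_matrix[OF assms] by simp

lemma inp_cost: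
  assumes "u < n" "v < n"
  shows "inp ! (2 + (n * n + n * n) + (u * n + v)) = K_cost c {u, v}"
  using index_less[OF assms] nth_matrix[OF assms]
  by (simp add: inp_def apbsp_input_def nth_append)

lemma mem_inp_less:
  assumes "x \<in> set inp"
  shows "x + 2 \<le> Max (set inp) + 2"
  using assms by simp

text \<open>In terms of \<open>m\<close>, the largest input number plus 2, the space is at most
  \<open>2 * m ^ 3 + 3 * m ^ 2 + 2\<close> and \<open>infty\<close> at most
  \<open>m ^ 3 + m + 1\<close>. A fixed power of \<open>m\<close> thus exceeds all values that
  occur, including sums of two distances.\<close>

lemma W_bounds:
  shows inp_less_W: "x \<in> set inp \<Longrightarrow> x < W"
    and S_le_W: "S \<le> W"
    and infty_less_W: "2 * infty + 2 < W"
    and num_less_W: "n < W" "n * n < W" "B + 2 < W" "10 < W"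
    and wmax_less_W: "n * wmax + 1 < W" "wmax < W"
proof -
  define m where "m = Max (set inp) + 2"
  have W: "W = m ^ 8" by (simp add: W_def word_bound_def m_def)
  have in_m: "x + 2 \<le> m" if "x \<in> set inp" for x
    using mem_inp_less[OF that] by (simp add: m_def)
  have n_m: "n + 2 \<le> m" and B_m: "B + 2 \<le> m"
    using in_m[of n] in_m[of B] by (simp_all add: inp_def apbsp_input_def)
  have w_m: "wmax \<le> m"
  proof -
    have "x \<le> m" if "x \<in> set (matrix n (K_weight w))" for x
      using in_m[of x] that by (simp add: inp_def apbsp_input_def)
    then show ?thesis
      unfolding wmax_def by (intro fold_max_le) auto
  qed
  have m3: "3 \<le> m" using n_m n by simp
  have pow: "m ^ i \<le> m ^ j" if "i \<le> j" for i j
    using m3 that by (intro power_increasing) auto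
  \<comment> \<open>Since \<open>n \<ge> 1\<close> gives \<open>m \<ge> 3\<close>, constant factors
    are paid for by raising the exponent.\<close>
  have mult3: "3 * m ^ i \<le> m ^ Suc i" for i
    using m3 by simp
  have nn: "n * n \<le> m ^ 2"
    using n_m by (simp add: power2_eq_square mult_le_mono)
  have Bnn: "Suc B * (n * n) \<le> m ^ 3"
    using mult_le_mono[of "Suc B" m "n * n" "m ^ 2"] B_m nn by (simp add: numeral_eq_Suc)
  have p: "m ^ 2 \<le> m ^ 3" "m ^ 3 \<le> m ^ 4" "m \<le> m ^ 2" "3 * m ^ 2 \<le> m ^ 3" "3 * m ^ 3 \<le> m ^ 4"
    "3 * m ^ 4 \<le> m ^ 5" "m ^ 5 \<le> m ^ 8" "3 * m ^ 5 \<le> m ^ 6" "m ^ 6 \<le> m ^ 8" "3 * m \<le> m ^ 2"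
    "3 * m ^ 6 \<le> m ^ 7" "m ^ 7 \<le> m ^ 8"
    using mult3[of 1] mult3[of 2] mult3[of 3] mult3[of 4] mult3[of 5] mult3[of 6] m3
    by (auto intro!: pow simp: numeral_eq_Suc)
  show "x < W" if "x \<in> set inp" for x
    using in_m[OF that] p unfolding W by linarith
  show "S \<le> W"
    unfolding W S_def xbase_def dbase_def using nn Bnn p m3 by linarith
  have nw: "n * wmax \<le> m ^ 2"
    using n_m w_m by (simp add: power2_eq_square mult_le_mono)
  have "n * (n * wmax + 1) \<le> m * (m ^ 2 + 1)"
    using nw n_m by (intro mult_le_mono) auto
  also have "\<dots> = m ^ 3 + m"
    by (simp add: numeral_eq_Suc)
  finally have "infty \<le> m ^ 3 + m + 1"
    unfolding infty_def by simp
  then show "2 * infty + 2 < W"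
    unfolding W using p m3 by linarith
  show "n < W" "n * n < W" "B + 2 < W" "n * wmax + 1 < W" "wmax < W"
    unfolding W using n_m nn B_m nw w_m p m3 by linarith+
  show "10 < W"
    unfolding W using p m3 by linarith
qed

lemma one_less_W [simp]: "Suc 0 < W" "0 < W" "1 < W"
  using num_less_W by auto

text \<open>What stays fixed once the setup is over: the parameters, the base addresses, the
  sentinel and the input region.\<close>

definition frame :: "(nat \<Rightarrow> nat) \<Rightarrow> (nat \<Rightarrow> nat) \<Rightarrow> bool" where
  "frame f m \<longleftrightarrow> f r_n = n \<and> f r_nn = n * n \<and> f r_B = Suc B \<and> f r_infty = infty
     \<and> f r_dist = dbase \<and> f r_next = xbase \<and> (\<forall>a<dbase. m a = inp ! a)"

lemma frame_upd_var [simp]: "8 \<le> x \<Longrightarrow> frame (f(x := y)) m \<longleftrightarrow> frame f m"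
  by (auto simp: frame_def)

lemma frame_upd_mem [simp]:
  "frame f (m(dbase + a := y)) \<longleftrightarrow> frame f m"
  "frame f (m(xbase + a := y)) \<longleftrightarrow> frame f m"
  by (auto simp: frame_def xbase_def)

lemma frameD:
  assumes "frame f m"
  shows "f r_n = n" "f r_nn = n * n" "f r_B = Suc B" "f r_infty = infty" "f r_dist = dbase"
    "f r_next = xbase" "a < dbase \<Longrightarrow> m a = inp ! a"
  using assms by (auto simp: frame_def)

section \<open>Evaluation and word bounds of the program's expressions\<close>

lemma ev_index [simp]:
  "vs s r_n = n \<Longrightarrow> ev (e_index p q) s = ev p s * n + ev q s"
  by (simp add: e_index_def)

lemma ok_index:
  assumes "vs s r_n = n" "ok S W p s" "ok S W q s" "ev p s < k" "ev q s < n" "k * n \<le> W"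
  shows "ok S W (e_index p q) s"
  using index_less[of "ev p s" k "ev q s"] assms by (simp add: e_index_def)

lemma adj_exp [simp]:
  assumes "frame (vs s) (ms s)" "ok S W p s" "ok S W q s" "ev p s < n" "ev q s < n"
  shows "ok S W (e_adj p q) s" "ev (e_adj p q) s = of_bool ({ev p s, ev q s} \<in> E)"
proof -
  have *: "2 + (ev p s * n + ev q s) < dbase"
    using index_less[of "ev p s" n "ev q s"] assms by (simp add: dbase_def)
  then have "2 + (ev p s * n + ev q s) < S"
    by (simp add: S_def xbase_def)
  then show "ok S W (e_adj p q) s"
    using frameD[OF assms(1)] inp_adj[of "ev p s" "ev q s"] assms * S_le_W num_less_W
      ok_index[of s p q n] by (simp add: e_adj_def)
  show "ev (e_adj p q) s = of_bool ({ev p s, ev q s} \<in> E)"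
    using frameD[OF assms(1)] inp_adj[of "ev p s" "ev q s"] assms * by (simp add: e_adj_def)
qed

lemma K_cost_less_W: "u < n \<Longrightarrow> x < n \<Longrightarrow> K_cost c {u, x} < W"
  by (rule inp_less_W) (simp add: inp_def apbsp_input_def mem_matrix)

lemma cost_exp [simp]:
  assumes "frame (vs s) (ms s)" "ok S W p s" "ok S W q s" "ev p s < n" "ev q s < n"
  shows "ok S W (e_cost p q) s" "ev (e_cost p q) s = K_cost c {ev p s, ev q s}"
proof -
  have *: "2 + (n * n + n * n) + (ev p s * n + ev q s) < dbase"
    using index_less[of "ev p s" n "ev q s"] assms by (simp add: dbase_def)
  then have "2 + (n * n + n * n) + (ev p s * n + ev q s) < S"
    by (simp add: S_def xbase_def)
  then show "ok S W (e_cost p q) s"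
    using frameD[OF assms(1)] inp_cost[of "ev p s" "ev q s"] assms * S_le_W num_less_W
      K_cost_less_W[of "ev p s" "ev q s"] ok_index[of s p q n] by (simp add: e_cost_def)
  show "ev (e_cost p q) s = K_cost c {ev p s, ev q s}"
    using frameD[OF assms(1)] inp_cost[of "ev p s" "ev q s"] assms * by (simp add: e_cost_def)
qed

lemma len_exp [simp]:
  assumes "frame (vs s) (ms s)" "ok S W p s" "ok S W q s" "ev p s < n" "ev q s < n"
  shows "ok S W (e_len p q) s" "ev (e_len p q) s = len (ev p s) (ev q s)"
proof -
  have *: "2 + n * n + (ev p s * n + ev q s) < dbase"
    using index_less[of "ev p s" n "ev q s"] assms by (simp add: dbase_def)
  then have "2 + n * n + (ev p s * n + ev q s) < S"
    by (simp add: S_def xbase_def)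
  moreover have "n * K_weight w {ev p s, ev q s} + 1 < W"
    using len_le_infty[of "ev p s" "ev q s"] infty_less_W assms by (simp add: len_def)
  moreover have "K_weight w {ev p s, ev q s} < W"
    using K_weight_le_wmax[of "ev p s" "ev q s"] wmax_less_W assms by simp
  ultimately show "ok S W (e_len p q) s"
    using frameD[OF assms(1)] inp_weight[of "ev p s" "ev q s"] assms * S_le_W num_less_W
      ok_index[of s p q n] by (simp add: e_len_def)
  show "ev (e_len p q) s = len (ev p s) (ev q s)"
    using frameD[OF assms(1)] inp_weight[of "ev p s" "ev q s"] assms *
    by (simp add: e_len_def len_def)
qed

lemma ev_address [simp]:
  assumes "frame (vs s) (ms s)"
  shows "ev (a_dist b p q) s = dbase + idx (ev b s) (ev p s) (ev q s)"
    "ev (a_next b p q) s = xbase + idx (ev b s) (ev p s) (ev q s)"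
  using frameD[OF assms] by (simp_all add: a_dist_def a_next_def idx_def)

lemma ok_address [simp]:
  assumes "frame (vs s) (ms s)" "ok S W b s" "ok S W p s" "ok S W q s"
    "ev b s \<le> B" "ev p s < n" "ev q s < n"
  shows "ok S W (a_dist b p q) s" "ok S W (a_next b p q) s"
proof -
  have "Suc B * n * n \<le> S"
    by (simp add: S_def algebra_simps)
  moreover have "Suc B * n * 1 \<le> Suc B * n * n"
    using n by (intro mult_le_mono) auto
  ultimately have W: "Suc B * n * n \<le> W" "Suc B * n \<le> W"
    using S_le_W by linarith+
  have "ok S W (e_index b p) s"
    using assms frameD[OF assms(1)] W by (intro ok_index[of s b p "Suc B"]) auto
  then have "ok S W (e_index (e_index b p) q) s"
    using assms frameD[OF assms(1)] W index_less[of "ev b s" "Suc B" "ev p s"]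
    by (intro ok_index[of s _ q "Suc B * n"]) auto
  then show "ok S W (a_dist b p q) s" "ok S W (a_next b p q) s"
    using frameD[OF assms(1)] assms S_le_W address_less_S[of "ev b s" "ev p s" "ev q s"]
    by (auto simp: a_dist_def a_next_def idx_def)
qed

lemma ev_diff [simp]: "ev (e_diff p q) s = (ev p s - ev q s) + (ev q s - ev p s)"
  by (simp add: e_diff_def)

lemma ok_diff [simp]:
  "ok S W p s \<Longrightarrow> ok S W q s \<Longrightarrow> ev p s < n \<Longrightarrow> ev q s < n \<Longrightarrow> ok S W (e_diff p q) s"
  using num_less_W by (auto simp: e_diff_def)

lemma wp_skip [simp]: "wp S W skip Q s \<longleftrightarrow> Q s"
  by (simp add: skip_def)

lemma wp_get_cost [simp]:
  assumes "frame (vs s) (ms s)" "ok S W p s" "ok S W q s" "ev p s < n" "ev q s < n"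
  shows "wp S W (get_cost p q) Q s \<longleftrightarrow> Q (s\<lparr>vs := (vs s)(r_cost := cost (ev p s) (ev q s))\<rparr>)"
  using assms by (simp add: get_cost_def cost_def)

text \<open>If \<open>u = v\<close> or \<open>v\<close> is out of reach, the cell may hold anything,
  because following a route never reads it.\<close>

definition next_ok :: "(nat \<Rightarrow> nat) \<Rightarrow> nat \<Rightarrow> nat \<Rightarrow> nat \<Rightarrow> bool" where
  "next_ok m \<beta> u v \<longleftrightarrow> (u \<noteq> v \<longrightarrow> dist \<beta> u v < infty \<longrightarrow>
     (let x = m (xbase + idx \<beta> u v) in x < n \<and> cost u x \<le> \<beta>
        \<and> dist \<beta> u v = len u x + dist (\<beta> - cost u x) x v))"

definition layers :: "(nat \<Rightarrow> nat) \<Rightarrow> nat \<Rightarrow> bool" where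
  "layers m b \<longleftrightarrow>
     (\<forall>\<beta><b. \<forall>u<n. \<forall>v<n. m (dbase + idx \<beta> u v) = dist \<beta> u v \<and> next_ok m \<beta> u v)"

lemma layers_upd [simp]:
  assumes "b \<le> B" "u < n" "v < n"
  shows "layers (m(dbase + idx b u v := y)) b \<longleftrightarrow> layers m b"
    "layers (m(xbase + idx b u v := y)) b \<longleftrightarrow> layers m b"
  using assms by (auto simp: layers_def next_ok_def)

lemma layersD: "layers m b \<Longrightarrow> \<beta> < b \<Longrightarrow> u < n \<Longrightarrow> v < n \<Longrightarrow> m (dbase + idx \<beta> u v) = dist \<beta> u v"
  by (auto simp: layers_def)

text \<open>Only finished layers are recorded. The counter \<open>k\<close> is a parameter because
  the closing loop runs its inner loops under a fixed \<open>k\<close>; the other phases carry it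
  along unchanged.\<close>

definition ctx :: "nat \<Rightarrow> nat \<Rightarrow> state \<Rightarrow> bool" where
  "ctx b k s \<longleftrightarrow> frame (vs s) (ms s) \<and> layers (ms s) b \<and> vs s r_b = b \<and> vs s r_k = k"

lemma sum_less_W: "x \<le> infty \<Longrightarrow> y \<le> infty \<Longrightarrow> x + y < W" "x \<le> infty \<Longrightarrow> x < W"
  using infty_less_W by auto

text \<open>The rule for a sweep over all pairs: \<open>P u v\<close> describes the state once all
  cells lexicographically before \<open>(u, v)\<close> have been treated, and \<open>row\<close>
  turns the end of one row into the start of the next.\<close>

lemma run_cells:
  assumes "ctx b k s" "P 0 0 (ms s) (os s)"
    and step: "\<And>u v s. u < n \<Longrightarrow> v < n \<Longrightarrow> ctx b k s \<Longrightarrow> vs s r_u = u \<Longrightarrow> vs s r_v = v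
      \<Longrightarrow> P u v (ms s) (os s) \<Longrightarrow> run S W body T
        (\<lambda>s'. ctx b k s' \<and> vs s' r_u = u \<and> vs s' r_v = v \<and> P u (Suc v) (ms s') (os s')) s"
    and row: "\<And>u m ys. u < n \<Longrightarrow> P u n m ys \<Longrightarrow> P (Suc u) 0 m ys"
    and Q: "\<And>s'. ctx b k s' \<Longrightarrow> P n 0 (ms s') (os s') \<Longrightarrow> Q s'"
  shows "run S W (For r_u r_n (For r_v r_n body)) (n * (n * (T + 40) + 40)) Q s"
proof (rule run_For'[where I = "\<lambda>u s. ctx b k s \<and> vs s r_u = u \<and> P u 0 (ms s) (os s)"])
  fix u s
  assume u: "ctx b k s \<and> vs s r_u = u \<and> P u 0 (ms s) (os s)" "u < n"
  show "run S W (For r_v r_n body) (n * (T + 40))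
    (\<lambda>s'. vs s' r_u = u \<and> (ctx b k (s'\<lparr>vs := (vs s')(r_u := Suc u)\<rparr>) \<and>
      vs (s'\<lparr>vs := (vs s')(r_u := Suc u)\<rparr>) r_u = Suc u \<and>
      P (Suc u) 0 (ms (s'\<lparr>vs := (vs s')(r_u := Suc u)\<rparr>)) (os (s'\<lparr>vs := (vs s')(r_u := Suc u)\<rparr>)))) s"
  proof (rule run_For'[where I = "\<lambda>v s. ctx b k s \<and> vs s r_u = u \<and> vs s r_v = v \<and> P u v (ms s) (os s)"])
    fix v s
    assume v: "ctx b k s \<and> vs s r_u = u \<and> vs s r_v = v \<and> P u v (ms s) (os s)" "v < n"
    show "run S W body T (\<lambda>s'. vs s' r_v = v \<and> (ctx b k (s'\<lparr>vs := (vs s')(r_v := Suc v)\<rparr>) \<and>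
        vs (s'\<lparr>vs := (vs s')(r_v := Suc v)\<rparr>) r_u = u \<and> vs (s'\<lparr>vs := (vs s')(r_v := Suc v)\<rparr>) r_v = Suc v \<and>
        P u (Suc v) (ms (s'\<lparr>vs := (vs s')(r_v := Suc v)\<rparr>)) (os (s'\<lparr>vs := (vs s')(r_v := Suc v)\<rparr>)))) s"
      by (rule run_mono[OF step]) (use u v in \<open>auto simp: ctx_def\<close>)
  qed (use u row n num_less_W frameD in \<open>auto simp: ctx_def\<close>)
qed (use assms n num_less_W frameD in \<open>auto simp: ctx_def\<close>)

section \<open>The initial matrix of a layer\<close>

lemma init_step:
  assumes "ctx b k s" "b \<le> B" "vs s r_u = u" "vs s r_v = v" "vs s r_x = x" "u < n" "v < n" "x < n"
    and "vs s r_acc \<le> infty"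
  shows "run S W init_step 2000
    (\<lambda>s'. ctx b k s' \<and> vs s' r_u = u \<and> vs s' r_v = v \<and> vs s' r_x = x \<and> ms s' = ms s \<and> os s' = os s
       \<and> vs s' r_acc = (if 0 < cost u x \<and> cost u x \<le> b
            then min (vs s r_acc) (len u x + dist (b - cost u x) x v) else vs s r_acc)) s"
proof (rule run_wp)
  show "2 * csize init_step \<le> 2000"
    by (simp add: init_step_def)
  \<comment> \<open>A positive cost leads to a layer strictly below \<open>b\<close>, which is
    finished.\<close>
  have "ms s (dbase + idx (b - cost u x) x v) = dist (b - cost u x) x v" if "0 < cost u x" "cost u x \<le> b"
    using layersD[of "ms s" b "b - cost u x" x v] that assms by (auto simp: ctx_def)
  then show "wp S W init_step
    (\<lambda>s'. ctx b k s' \<and> vs s' r_u = u \<and> vs s' r_v = v \<and> vs s' r_x = x \<and> ms s' = ms s \<and> os s' = os s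
       \<and> vs s' r_acc = (if 0 < cost u x \<and> cost u x \<le> b
            then min (vs s r_acc) (len u x + dist (b - cost u x) x v) else vs s r_acc)) s"
    using assms len_le_infty[of u x] dist_le_infty[of "b - cost u x" x v] num_less_W
      sum_less_W(1)[OF len_le_infty[of u x] dist_le_infty[of "b - cost u x" x v]]
      sum_less_W(2)[OF dist_le_infty[of "b - cost u x" x v]]
      frameD[of "vs s" "ms s"]
    by (auto simp: init_step_def ctx_def min_def)
qed

lemma init_start:
  assumes "ctx b k s" "b \<le> B" "vs s r_u = u" "vs s r_v = v" "u < n" "v < n"
  shows "run S W init_start 2000
    (\<lambda>s'. ctx b k s' \<and> vs s' r_u = u \<and> vs s' r_v = v \<and> ms s' = ms s \<and> os s' = os s
       \<and> vs s' r_acc = (if u = v then 0 else if {u, v} \<in> E then len u v else infty)) s"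
proof (rule run_wp)
  show "2 * csize init_start \<le> 2000"
    by (simp add: init_start_def)
  show "wp S W init_start (\<lambda>s'. ctx b k s' \<and> vs s' r_u = u \<and> vs s' r_v = v \<and> ms s' = ms s \<and> os s' = os s
       \<and> vs s' r_acc = (if u = v then 0 else if {u, v} \<in> E then len u v else infty)) s"
    using assms frameD[of "vs s" "ms s"]
    by (auto simp: init_start_def ctx_def)
qed

text \<open>The loop invariant behind \<open>initial\<close>: only first steps to vertices below
  \<open>x\<close> have been taken into account, and \<open>x = n\<close> gives
  \<open>initial\<close>.\<close>

definition cand_bound :: "nat \<Rightarrow> nat \<Rightarrow> nat \<Rightarrow> nat \<Rightarrow> nat \<Rightarrow> bool" where
  "cand_bound b u v x y \<longleftrightarrow> dist b u v \<le> y \<and> y \<le> infty \<and> (u = v \<longrightarrow> y = 0)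
     \<and> ({u, v} \<in> E \<longrightarrow> y \<le> len u v)
     \<and> (\<forall>x'<x. 0 < cost u x' \<longrightarrow> cost u x' \<le> b \<longrightarrow> y \<le> len u x' + dist (b - cost u x') x' v)"

lemma cand_bound_0:
  assumes "u < n" "v < n"
  shows "cand_bound b u v 0 (if u = v then 0 else if {u, v} \<in> E then len u v else infty)"
  using dist_le_step[of u v b v] dist_refl assms dist_le_infty len_le_infty
  by (auto simp: cand_bound_def cost_def)

lemma cand_bound_Suc:
  assumes "cand_bound b u v x y" "u < n"
  shows "cand_bound b u v (Suc x) (if 0 < cost u x \<and> cost u x \<le> b
            then min y (len u x + dist (b - cost u x) x v) else y)"
  using assms dist_le_step[of u x b v] by (auto simp: cand_bound_def less_Suc_eq min_le_iff_disj)

lemma cand_bound_n: "cand_bound b u v n y \<longleftrightarrow> initial b u v y"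
  by (simp add: cand_bound_def initial_def)

lemma init_phase:
  assumes s: "ctx b k s" and b: "b \<le> B"
  shows "run S W init_phase (n * (n * (n * 2040 + 4040) + 40))
    (\<lambda>s'. ctx b k s' \<and> os s' = os s
       \<and> (\<forall>u<n. \<forall>v<n. initial b u v (ms s' (dbase + idx b u v)))) s"
  unfolding init_phase_def
proof (rule run_mono[OF run_cells[where P = "\<lambda>u v m ys. ys = os s \<and>
      (\<forall>u'<n. \<forall>v'<n. u' < u \<or> u' = u \<and> v' < v \<longrightarrow> initial b u' v' (m (dbase + idx b u' v')))"]])
  fix u v s0
  assume uv: "u < n" "v < n" and s0: "ctx b k s0" "vs s0 r_u = u" "vs s0 r_v = v"
    and P: "os s0 = os s \<and>
      (\<forall>u'<n. \<forall>v'<n. u' < u \<or> u' = u \<and> v' < v \<longrightarrow> initial b u' v' (ms s0 (dbase + idx b u' v')))"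
  let ?Q = "\<lambda>s'. ctx b k s' \<and> vs s' r_u = u \<and> vs s' r_v = v \<and> os s' = os s \<and>
      (\<forall>u'<n. \<forall>v'<n. u' < u \<or> u' = u \<and> v' < Suc v \<longrightarrow> initial b u' v' (ms s' (dbase + idx b u' v')))"
  let ?I = "\<lambda>x s'. ctx b k s' \<and> vs s' r_u = u \<and> vs s' r_v = v \<and> ms s' = ms s0 \<and> os s' = os s
      \<and> vs s' r_x = x \<and> cand_bound b u v x (vs s' r_acc)"
  show "run S W (init_start ;; For r_x r_n init_step ;;
      Sto (a_dist (Var r_b) (Var r_u) (Var r_v)) (Var r_acc)) (2000 + (n * (2000 + 40) + 1000)) ?Q s0"
  proof (rule run_Seq'[OF init_start[OF s0(1) b s0(2,3) uv]], elim conjE, rule run_Seq')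
    fix s1
    assume s1: "ctx b k s1" "vs s1 r_u = u" "vs s1 r_v = v" "ms s1 = ms s0" "os s1 = os s0"
      "vs s1 r_acc = (if u = v then 0 else if {u, v} \<in> E then len u v else infty)"
    show "run S W (For r_x r_n init_step) (n * (2000 + 40)) (?I n) s1"
    proof (rule run_For'[where I = ?I])
      fix x s2
      assume I: "?I x s2" and x: "x < n"
      then have "vs s2 r_acc \<le> infty"
        by (simp add: cand_bound_def)
      moreover note cand_bound_Suc[of b u v x "vs s2 r_acc"]
      ultimately show "run S W init_step 2000
          (\<lambda>s'. vs s' r_x = x \<and> ?I (Suc x) (s'\<lparr>vs := (vs s')(r_x := Suc x)\<rparr>)) s2"
        using I x uv b by (intro run_mono[OF init_step[of b k s2 u v x]]) (auto simp: ctx_def)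
    qed (use s1 P cand_bound_0[OF uv, of b] n num_less_W frameD in \<open>auto simp: ctx_def\<close>)
    fix s2
    assume I: "?I n s2"
    let ?m = "(ms s2)(dbase + idx b u v := vs s2 r_acc)"
    have "initial b u v (vs s2 r_acc)"
      using I by (simp add: cand_bound_n)
    then have m: "\<forall>u'<n. \<forall>v'<n. u' < u \<or> u' = u \<and> v' < Suc v \<longrightarrow> initial b u' v' (?m (dbase + idx b u' v'))"
      using P uv I by (simp add: less_Suc_eq)
    show "run S W (Sto (a_dist (Var r_b) (Var r_u) (Var r_v)) (Var r_acc)) 1000 ?Q s2"
    proof (rule run_wp)
      show "wp S W (Sto (a_dist (Var r_b) (Var r_u) (Var r_v)) (Var r_acc)) ?Q s2"
        using I uv b m by (elim conjE) (simp add: ctx_def)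
    qed simp
  qed
qed (use s in \<open>auto simp: less_Suc_eq algebra_simps\<close>)

end


section \<open>Computing the layers\<close>

context apbsp_ram
begin

text \<open>All cells lie between the true distances and their values at the start of the round, so
  a cell read after its update can only sharpen the bound. \<open>Z u\<close> is the left factor:
  the value at the start of the round if layer 0 itself is being closed, and the final distance
  otherwise.\<close>

lemma close_round:
  assumes s: "ctx b k s" and b: "b \<le> B" and k: "k < n"
    and D: "\<And>u v. u < n \<Longrightarrow> v < n \<Longrightarrow>
      dist b u v \<le> ms s (dbase + idx b u v) \<and> ms s (dbase + idx b u v) \<le> infty"
  defines "Z \<equiv> \<lambda>u. if b = 0 then ms s (dbase + idx 0 u k) else dist 0 u k"
  shows "run S W (For r_u r_n (For r_v r_n
     (Assign r_cand (Plus (Ld (a_dist (Num 0) (Var r_u) (Var r_k)))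
        (Ld (a_dist (Var r_b) (Var r_k) (Var r_v)))) ;;
      If (Var r_cand) (Ld (a_dist (Var r_b) (Var r_u) (Var r_v)))
        (Sto (a_dist (Var r_b) (Var r_u) (Var r_v)) (Var r_cand)) skip)))
     (n * (n * 1040 + 40))
    (\<lambda>s'. ctx b k s' \<and> os s' = os s \<and> (\<forall>u<n. \<forall>v<n.
        dist b u v \<le> ms s' (dbase + idx b u v)
      \<and> ms s' (dbase + idx b u v) \<le> ms s (dbase + idx b u v)
      \<and> ms s' (dbase + idx b u v) \<le> Z u + ms s (dbase + idx b k v))) s"
proof (rule run_mono[OF run_cells[where T = 1000 and P = "\<lambda>u v m ys. ys = os s \<and> (\<forall>u'<n. \<forall>v'<n.
        dist b u' v' \<le> m (dbase + idx b u' v')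
      \<and> m (dbase + idx b u' v') \<le> ms s (dbase + idx b u' v')
      \<and> (u' < u \<or> u' = u \<and> v' < v \<longrightarrow>
           m (dbase + idx b u' v') \<le> Z u' + ms s (dbase + idx b k v')))"]])
  fix u v s0
  assume uv: "u < n" "v < n" and s0: "ctx b k s0" "vs s0 r_u = u" "vs s0 r_v = v"
    and P: "os s0 = os s \<and> (\<forall>u'<n. \<forall>v'<n.
        dist b u' v' \<le> ms s0 (dbase + idx b u' v')
      \<and> ms s0 (dbase + idx b u' v') \<le> ms s (dbase + idx b u' v')
      \<and> (u' < u \<or> u' = u \<and> v' < v \<longrightarrow>
           ms s0 (dbase + idx b u' v') \<le> Z u' + ms s (dbase + idx b k v')))"
  let ?a = "ms s0 (dbase + idx 0 u k)" and ?b = "ms s0 (dbase + idx b k v)"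
  let ?d = "ms s0 (dbase + idx b u v)"
  have a: "dist 0 u k \<le> ?a" "?a \<le> Z u" "?a \<le> infty"
  proof -
    have "dist 0 u k \<le> ?a \<and> ?a \<le> Z u \<and> ?a \<le> infty"
    proof (cases "b = 0")
      case True
      \<comment> \<open>Column \<open>k\<close> belongs to the matrix under update here, but its
        cells have only decreased since the round began.\<close>
      have "dist b u k \<le> ms s0 (dbase + idx b u k)"
        "ms s0 (dbase + idx b u k) \<le> ms s (dbase + idx b u k)"
        using P uv k by blast+
      then show ?thesis using D[OF uv(1) k] True by (simp add: Z_def)
    next
      case False
      then have "?a = dist 0 u k"
        using layersD[of "ms s0" b 0 u k] s0 uv k by (simp add: ctx_def)
      with False show ?thesis using dist_le_infty by (simp add: Z_def)
    qed
    then show "dist 0 u k \<le> ?a" "?a \<le> Z u" "?a \<le> infty" by auto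
  qed
  have b': "dist b k v \<le> ?b" "?b \<le> ms s (dbase + idx b k v)" "?b \<le> infty"
    using P D[OF k uv(2)] uv k le_trans by blast+
  have d: "dist b u v \<le> ?d" "?d \<le> infty"
    using P D[OF uv] uv le_trans by blast+
  \<comment> \<open>Both summands are at least distances, so the candidate cannot undercut the true
    distance.\<close>
  have low: "dist b u v \<le> ?a + ?b"
    using dist_triangle[of b u v k] a b' by linarith
  have up: "min (?a + ?b) ?d \<le> Z u + ms s (dbase + idx b k v)"
    using a b' by linarith
  define m where "m = (if ?a + ?b < ?d then (ms s0)(dbase + idx b u v := ?a + ?b) else ms s0)"
  have m: "dist b u' v' \<le> m (dbase + idx b u' v')
      \<and> m (dbase + idx b u' v') \<le> ms s (dbase + idx b u' v')
      \<and> (u' < u \<or> u' = u \<and> v' < Suc v \<longrightarrow>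
           m (dbase + idx b u' v') \<le> Z u' + ms s (dbase + idx b k v'))"
    if uv': "u' < n" "v' < n" for u' v'
  proof (cases "u' = u \<and> v' = v")
    case True
    then have "m (dbase + idx b u' v') = min (?a + ?b) ?d"
      by (simp add: m_def)
    moreover have "?d \<le> ms s (dbase + idx b u v)"
      using P uv by blast
    ultimately show ?thesis
      using True low up d by (auto simp: min_le_iff_disj)
  next
    case False
    then have "m (dbase + idx b u' v') = ms s0 (dbase + idx b u' v')"
      using uv uv' by (auto simp: m_def)
    with False P uv' show ?thesis
      by (auto simp: less_Suc_eq)
  qed
  show "run S W
     (Assign r_cand (Plus (Ld (a_dist (Num 0) (Var r_u) (Var r_k)))
        (Ld (a_dist (Var r_b) (Var r_k) (Var r_v)))) ;;
      If (Var r_cand) (Ld (a_dist (Var r_b) (Var r_u) (Var r_v)))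
        (Sto (a_dist (Var r_b) (Var r_u) (Var r_v)) (Var r_cand)) skip) 1000
     (\<lambda>s'. ctx b k s' \<and> vs s' r_u = u \<and> vs s' r_v = v \<and> os s' = os s \<and> (\<forall>u'<n. \<forall>v'<n.
        dist b u' v' \<le> ms s' (dbase + idx b u' v')
      \<and> ms s' (dbase + idx b u' v') \<le> ms s (dbase + idx b u' v')
      \<and> (u' < u \<or> u' = u \<and> v' < Suc v \<longrightarrow>
           ms s' (dbase + idx b u' v') \<le> Z u' + ms s (dbase + idx b k v')))) s0"
  proof (rule run_mono[OF run_wp[where T = 1000]])
    show "wp S W
     (Assign r_cand (Plus (Ld (a_dist (Num 0) (Var r_u) (Var r_k)))
        (Ld (a_dist (Var r_b) (Var r_k) (Var r_v)))) ;;
      If (Var r_cand) (Ld (a_dist (Var r_b) (Var r_u) (Var r_v)))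
        (Sto (a_dist (Var r_b) (Var r_u) (Var r_v)) (Var r_cand)) skip)
      (\<lambda>s'. ctx b k s' \<and> vs s' r_u = u \<and> vs s' r_v = v \<and> os s' = os s \<and> ms s' = m) s0"
      using s0 uv b k P sum_less_W(1)[OF a(3) b'(3)] sum_less_W(2)[OF a(3)] sum_less_W(2)[OF b'(3)]
        sum_less_W(2)[OF d(2)]
      by (simp add: ctx_def m_def)
  qed (use m in simp_all)
qed (use s D in \<open>auto simp: less_Suc_eq algebra_simps\<close>)

lemma close_phase:
  assumes s: "ctx b k s" and b: "b \<le> B"
    and M: "\<And>u v. u < n \<Longrightarrow> v < n \<Longrightarrow> initial b u v (ms s (dbase + idx b u v))"
  shows "run S W close_phase (n * (n * (n * 1040 + 40) + 40))
    (\<lambda>s'. ctx b n s' \<and> os s' = os s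
       \<and> (\<forall>u<n. \<forall>v<n. ms s' (dbase + idx b u v) = dist b u v)) s"
proof -
  \<comment> \<open>The lower bound is common to all layers, the upper bound is not. For
    \<open>b > 0\<close> the last conjunct refers to the matrix at the start of the phase: the left
    factor \<open>dist 0\<close> is final, so one relaxation through each \<open>y\<close> yields
    the whole min-plus product.\<close>
  define I where "I = (\<lambda>k s'. ctx b k s' \<and> os s' = os s
    \<and> (\<forall>u<n. \<forall>v<n. dist b u v \<le> ms s' (dbase + idx b u v)
        \<and> ms s' (dbase + idx b u v) \<le> ms s (dbase + idx b u v))
    \<and> (b = 0 \<longrightarrow> floyd_warshall k (\<lambda>u v. ms s' (dbase + idx 0 u v)))
    \<and> (b > 0 \<longrightarrow> (\<forall>u<n. \<forall>v<n. \<forall>y<k.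
        ms s' (dbase + idx b u v) \<le> dist 0 u y + ms s (dbase + idx b y v))))"
  have M': "dist b u v \<le> ms s (dbase + idx b u v)" "ms s (dbase + idx b u v) \<le> infty"
    if "u < n" "v < n" for u v
    using M[OF that] by (auto simp: initial_def)
  show ?thesis
    unfolding close_phase_def
  proof (rule run_For'[where I = I])
    show "I 0 (s\<lparr>vs := (vs s)(r_k := 0)\<rparr>)"
      using s M M' floyd_warshall_0[of "\<lambda>u v. ms s (dbase + idx 0 u v)"]
      by (auto simp: I_def ctx_def)
    show "vs s0 r_k = i \<and> vs s0 r_n = n" if "I i s0" for i s0
      using that frameD by (auto simp: I_def ctx_def)
  next
    fix i s0
    assume I: "I i s0" and i: "i < n"
    have s0: "ctx b i s0"
      using I by (simp add: I_def)
    have D: "dist b u v \<le> ms s0 (dbase + idx b u v)"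
      "ms s0 (dbase + idx b u v) \<le> ms s (dbase + idx b u v)" if "u < n" "v < n" for u v
      using I that unfolding I_def by blast+
    have D': "dist b u v \<le> ms s0 (dbase + idx b u v) \<and> ms s0 (dbase + idx b u v) \<le> infty"
      if "u < n" "v < n" for u v
      using D[OF that] M'[OF that] le_trans by blast
    show "run S W (For r_u r_n (For r_v r_n
     (Assign r_cand (Plus (Ld (a_dist (Num 0) (Var r_u) (Var r_k)))
        (Ld (a_dist (Var r_b) (Var r_k) (Var r_v)))) ;;
      If (Var r_cand) (Ld (a_dist (Var r_b) (Var r_u) (Var r_v)))
        (Sto (a_dist (Var r_b) (Var r_u) (Var r_v)) (Var r_cand)) skip)))
     (n * (n * 1040 + 40)) (\<lambda>s'. vs s' r_k = i \<and> I (Suc i) (s'\<lparr>vs := (vs s')(r_k := Suc i)\<rparr>)) s0"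
    proof (rule run_mono[OF close_round[OF s0 b i D'] order_refl])
      fix s1
      assume s1: "ctx b i s1 \<and> os s1 = os s0 \<and> (\<forall>u<n. \<forall>v<n.
            dist b u v \<le> ms s1 (dbase + idx b u v)
          \<and> ms s1 (dbase + idx b u v) \<le> ms s0 (dbase + idx b u v)
          \<and> ms s1 (dbase + idx b u v)
             \<le> (if b = 0 then ms s0 (dbase + idx 0 u i) else dist 0 u i) + ms s0 (dbase + idx b i v))"
      have 1: "dist b u v \<le> ms s1 (dbase + idx b u v)"
        "ms s1 (dbase + idx b u v) \<le> ms s (dbase + idx b u v)" if "u < n" "v < n" for u v
        using s1 D[OF that] that le_trans by blast+
      have 2: "floyd_warshall (Suc i) (\<lambda>u v. ms s1 (dbase + idx 0 u v))" if "b = 0"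
      proof (rule floyd_warshall_Suc[OF _ i])
        show "floyd_warshall i (\<lambda>u v. ms s0 (dbase + idx 0 u v))"
          using I that by (simp add: I_def)
      qed (use s1 that in auto)
      have 3: "ms s1 (dbase + idx b u v) \<le> dist 0 u y + ms s (dbase + idx b y v)"
        if "b > 0" "u < n" "v < n" "y < Suc i" for u v y
      proof (cases "y = i")
        case True
        \<comment> \<open>The round bounds the cell by its own starting values, and these are at
          most the values at the start of the phase.\<close>
        have "ms s1 (dbase + idx b u v) \<le> dist 0 u i + ms s0 (dbase + idx b i v)"
          using s1 that by auto
        with D(2)[OF i \<open>v < n\<close>] True show ?thesis by simp
      next
        case False
        then have "ms s0 (dbase + idx b u v) \<le> dist 0 u y + ms s (dbase + idx b y v)"
          using I that by (simp add: I_def)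
        moreover have "ms s1 (dbase + idx b u v) \<le> ms s0 (dbase + idx b u v)"
          using s1 that by blast
        ultimately show ?thesis by simp
      qed
      show "vs s1 r_k = i \<and> I (Suc i) (s1\<lparr>vs := (vs s1)(r_k := Suc i)\<rparr>)"
        using s1 I 1 2 3 by (simp add: I_def ctx_def)
    qed
  next
    fix s'
    assume I: "I n s'"
    have "ms s' (dbase + idx b u v) = dist b u v" if uv: "u < n" "v < n" for u v
    proof (rule antisym)
      show "dist b u v \<le> ms s' (dbase + idx b u v)"
        using I uv by (simp add: I_def)
      have le: "ms s' (dbase + idx b u v) \<le> ms s (dbase + idx b u v)"
        using I uv by (simp add: I_def)
      show "ms s' (dbase + idx b u v) \<le> dist b u v"
      proof (cases "b = 0")
        case True
        show ?thesis
          unfolding True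
        proof (rule floyd_warshall_le_dist)
          show "floyd_warshall n (\<lambda>u v. ms s' (dbase + idx 0 u v))"
            using I True by (simp add: I_def)
        qed (use uv le True M[OF uv] in \<open>auto simp: initial_def\<close>)
      next
        case False
        show ?thesis
        proof (rule layer_le_dist[where M = "\<lambda>y. ms s (dbase + idx b y v)" and D = "\<lambda>u. ms s' (dbase + idx b u v)"])
          show "ms s' (dbase + idx b u' v) \<le> dist 0 u' y + ms s (dbase + idx b y v)"
            if "u' < n" "y < n" for u' y
            using I that uv False by (simp add: I_def)
        qed (use uv M in auto)
      qed
    qed
    then show "ctx b n s' \<and> os s' = os s \<and> (\<forall>u<n. \<forall>v<n. ms s' (dbase + idx b u v) = dist b u v)"
      using I by (simp add: I_def)
  qed (use n num_less_W in auto)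
qed

section \<open>First steps of shortest walks\<close>

definition good_next :: "nat \<Rightarrow> nat \<Rightarrow> nat \<Rightarrow> nat \<Rightarrow> bool" where
  "good_next b u v x \<longleftrightarrow> cost u x \<le> b \<and> dist b u v = len u x + dist (b - cost u x) x v"

lemma next_step:
  assumes "ctx b k s" "b \<le> B" "vs s r_u = u" "vs s r_v = v" "vs s r_x = x" "u < n" "v < n" "x < n"
    and D: "\<And>u v. u < n \<Longrightarrow> v < n \<Longrightarrow> ms s (dbase + idx b u v) = dist b u v"
  shows "run S W next_step 2000
    (\<lambda>s'. ctx b k s' \<and> vs s' r_u = u \<and> vs s' r_v = v \<and> vs s' r_x = x \<and> ms s' = ms s \<and> os s' = os s
       \<and> vs s' r_acc = (if good_next b u v x then x else vs s r_acc)) s"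
proof (rule run_wp)
  show "2 * csize next_step \<le> 2000"
    by (simp add: next_step_def)
  \<comment> \<open>A free step stays in layer \<open>b\<close>, whose distances are known from
    \<open>D\<close>; a step with a cost leads to a lower layer.\<close>
  have 1: "ms s (dbase + idx (b - cost u x) x v) = dist (b - cost u x) x v" if "cost u x \<le> b"
    using layersD[of "ms s" b "b - cost u x" x v] that assms D[of x v]
    by (cases "cost u x = 0") (auto simp: ctx_def)
  \<comment> \<open>By \<open>dist_le_step\<close> the candidate is at least the distance, so the
    strict test against the successor expresses equality.\<close>
  have 2: "good_next b u v x \<longleftrightarrow> cost u x < Suc b \<and> len u x + dist (b - cost u x) x v < Suc (dist b u v)"
    using dist_le_step[of u x b v] assms by (auto simp: good_next_def)
  show "wp S W next_step
    (\<lambda>s'. ctx b k s' \<and> vs s' r_u = u \<and> vs s' r_v = v \<and> vs s' r_x = x \<and> ms s' = ms s \<and> os s' = os s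
       \<and> vs s' r_acc = (if good_next b u v x then x else vs s r_acc)) s"
    using assms(1-8) len_le_infty[of u x] num_less_W 1 D[of u v]
      sum_less_W(1)[OF len_le_infty[of u x] dist_le_infty[of "b - cost u x" x v]]
      sum_less_W(2)[OF dist_le_infty[of "b - cost u x" x v]]
      sum_less_W(2)[OF dist_le_infty[of b u v]] infty_less_W dist_le_infty[of b u v]
      frameD[of "vs s" "ms s"]
    by (auto simp: next_step_def ctx_def 2)
qed

lemma next_phase:
  assumes s: "ctx b k s" and b: "b \<le> B"
    and D: "\<And>u v. u < n \<Longrightarrow> v < n \<Longrightarrow> ms s (dbase + idx b u v) = dist b u v"
  shows "run S W next_phase (n * (n * (n * 2040 + 2040) + 40))
    (\<lambda>s'. ctx b k s' \<and> os s' = os s \<and> layers (ms s') (Suc b)) s"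
  unfolding next_phase_def
proof (rule run_mono[OF run_cells[where P = "\<lambda>u v m ys. ys = os s \<and>
      (\<forall>u'<n. \<forall>v'<n. m (dbase + idx b u' v') = dist b u' v'
        \<and> (u' < u \<or> u' = u \<and> v' < v \<longrightarrow> next_ok m b u' v'))"]])
  fix u v s0
  assume uv: "u < n" "v < n" and s0: "ctx b k s0" "vs s0 r_u = u" "vs s0 r_v = v"
    and P: "os s0 = os s \<and> (\<forall>u'<n. \<forall>v'<n. ms s0 (dbase + idx b u' v') = dist b u' v'
        \<and> (u' < u \<or> u' = u \<and> v' < v \<longrightarrow> next_ok (ms s0) b u' v'))"
  let ?Q = "\<lambda>s'. ctx b k s' \<and> vs s' r_u = u \<and> vs s' r_v = v \<and> os s' = os s \<and>
      (\<forall>u'<n. \<forall>v'<n. ms s' (dbase + idx b u' v') = dist b u' v'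
        \<and> (u' < u \<or> u' = u \<and> v' < Suc v \<longrightarrow> next_ok (ms s') b u' v'))"
  \<comment> \<open>The accumulator starts with 0 as a mere default, so it is claimed to be good
    only once a good vertex has been scanned.\<close>
  let ?I = "\<lambda>x s'. ctx b k s' \<and> vs s' r_u = u \<and> vs s' r_v = v \<and> ms s' = ms s0 \<and> os s' = os s
      \<and> vs s' r_x = x \<and> ((\<exists>x'<x. good_next b u v x') \<longrightarrow> vs s' r_acc < n \<and> good_next b u v (vs s' r_acc))"
  show "run S W (Assign r_acc (Num 0) ;; For r_x r_n next_step ;;
      Sto (a_next (Var r_b) (Var r_u) (Var r_v)) (Var r_acc)) (100 + (n * (2000 + 40) + 1000)) ?Q s0"
  \<comment> \<open>The loop begins by resetting \<open>r_x\<close>, so the invariant is handed over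
    for the state after that reset.\<close>
  proof (rule run_Seq'[where R = "?I 0 \<circ> (\<lambda>s. s\<lparr>vs := (vs s)(r_x := 0)\<rparr>)"], rule run_wp, goal_cases)
    case 1
    then show ?case using s0 P by (simp add: ctx_def)
  next
    case 2
    then show ?case by simp
  next
    case (3 s1)
    show ?case
    proof (rule run_Seq')
      show "run S W (For r_x r_n next_step) (n * (2000 + 40)) (?I n) s1"
      proof (rule run_For'[where I = ?I])
        fix x s2
        assume I: "?I x s2" and x: "x < n"
        then show "run S W next_step 2000
            (\<lambda>s'. vs s' r_x = x \<and> ?I (Suc x) (s'\<lparr>vs := (vs s')(r_x := Suc x)\<rparr>)) s2"
          using I x uv b P by (intro run_mono[OF next_step[of b k s2 u v x]])
            (auto simp: ctx_def less_Suc_eq)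
      next
        show "?I 0 (s1\<lparr>vs := (vs s1)(r_x := 0)\<rparr>)"
          using 3 by simp
      qed (use n num_less_W frameD in \<open>auto simp: ctx_def\<close>)
      fix s2
      assume I: "?I n s2"
      let ?m = "(ms s2)(xbase + idx b u v := vs s2 r_acc)"
      have "next_ok ?m b u v"
        unfolding next_ok_def Let_def
      proof (intro impI)
        assume "u \<noteq> v" "dist b u v < infty"
        \<comment> \<open>Some first step is tight, so the scan over all vertices replaces the
          default by a valid choice.\<close>
        then have "\<exists>x'<n. good_next b u v x'"
          by (metis dist_eq_step good_next_def)
        with I have "vs s2 r_acc < n \<and> good_next b u v (vs s2 r_acc)"
          by blast
        then show "?m (xbase + idx b u v) < n \<and> cost u (?m (xbase + idx b u v)) \<le> b \<and>
          dist b u v = len u (?m (xbase + idx b u v))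
            + dist (b - cost u (?m (xbase + idx b u v))) (?m (xbase + idx b u v)) v"
          by (simp add: good_next_def)
      qed
      moreover have "next_ok ?m b u' v' \<longleftrightarrow> next_ok (ms s0) b u' v'"
        if "u' < n" "v' < n" "u' \<noteq> u \<or> v' \<noteq> v" for u' v'
        using that I uv by (auto simp: next_ok_def)
      moreover have "?m (dbase + idx b u' v') = dist b u' v'" if "u' < n" "v' < n" for u' v'
        using that I b P by simp
      ultimately have m: "\<forall>u'<n. \<forall>v'<n. ?m (dbase + idx b u' v') = dist b u' v'
          \<and> (u' < u \<or> u' = u \<and> v' < Suc v \<longrightarrow> next_ok ?m b u' v')"
        using P uv by (metis less_Suc_eq less_irrefl)
      show "run S W (Sto (a_next (Var r_b) (Var r_u) (Var r_v)) (Var r_acc)) 1000 ?Q s2"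
      proof (rule run_wp)
        show "wp S W (Sto (a_next (Var r_b) (Var r_u) (Var r_v)) (Var r_acc)) ?Q s2"
          using I uv b m by (elim conjE) (simp add: ctx_def)
      qed simp
    qed
  qed
qed (use s D in \<open>auto simp: less_Suc_eq algebra_simps layers_def ctx_def\<close>)

end


section \<open>Printing the paths\<close>

text \<open>The output as \<open>N\<close> consecutive blocks, nested once each for
  \<open>\<beta>\<close>, \<open>u\<close> and \<open>v\<close>. The blocks are existentially
  quantified, so loop invariants need not fix which of several shortest paths is written.\<close>

definition seqs :: "(nat \<Rightarrow> nat list \<Rightarrow> bool) \<Rightarrow> nat \<Rightarrow> nat list \<Rightarrow> bool" where
  "seqs R N ys \<longleftrightarrow> (\<exists>g. (\<forall>i<N. R i (g i)) \<and> ys = concat (map g [0..<N]))"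

lemma seqs_0 [simp]: "seqs R 0 ys \<longleftrightarrow> ys = []"
  by (simp add: seqs_def)

lemma seqs_Suc: "seqs R N ys \<Longrightarrow> R N zs \<Longrightarrow> seqs R (Suc N) (ys @ zs)"
proof -
  assume "seqs R N ys" "R N zs"
  then obtain g where "\<forall>i<N. R i (g i)" "ys = concat (map g [0..<N])"
    by (auto simp: seqs_def)
  with \<open>R N zs\<close> show ?thesis
    unfolding seqs_def by (intro exI[of _ "g(N := zs)"]) (auto simp: less_Suc_eq)
qed

context apbsp_ram
begin

text \<open>The vertices met when the stored next vertices are followed from \<open>p\<close> with
  remaining budget \<open>r\<close>. The fuel \<open>f\<close> only serves termination; the distance
  is enough of it.\<close>

fun route :: "(nat \<Rightarrow> nat) \<Rightarrow> nat \<Rightarrow> nat \<Rightarrow> nat \<Rightarrow> nat \<Rightarrow> nat list" where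
  "route m v 0 r p = [v]"
| "route m v (Suc f) r p = (if p = v then [v]
     else p # route m v f (r - cost p (m (xbase + idx r p v))) (m (xbase + idx r p v)))"

lemma route_nonempty [simp]: "route m v f r p \<noteq> []"
  by (cases f) auto

lemma layers_nextD:
  assumes "layers m (Suc b)" "r \<le> b" "p < n" "v < n" "p \<noteq> v" "dist r p v < infty"
  shows "m (xbase + idx r p v) < n" "cost p (m (xbase + idx r p v)) \<le> r"
    "dist r p v = len p (m (xbase + idx r p v))
       + dist (r - cost p (m (xbase + idx r p v))) (m (xbase + idx r p v)) v"
  using assms unfolding layers_def next_ok_def Let_def by (auto simp: less_Suc_eq_le)

text \<open>Every stored step is tight and has length at least 1. So the remaining distance drops
  with each step, the fuel lasts until \<open>v\<close>, and the lengths add up to the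
  distance.\<close>

lemma route_shortest:
  assumes "layers m (Suc b)" "r \<le> b" "p < n" "v < n" "dist r p v < infty" "dist r p v \<le> f"
  shows "walk r p v (route m v f r p) \<and> walk_len (route m v f r p) = dist r p v"
  using assms(2-6)
proof (induction f arbitrary: r p)
  case 0
  have "p = v"
  proof (rule ccontr)
    assume "p \<noteq> v"
    from layers_nextD(3)[OF assms(1) 0(1,2,3) this 0(4)] 0(5) show False
      by (simp add: len_def)
  qed
  with 0 show ?case by (simp add: walk_singleI dist_refl)
next
  case (Suc f)
  show ?case
  proof (cases "p = v")
    case True
    with Suc show ?thesis by (simp add: walk_singleI dist_refl)
  next
    case False
    define x where "x = m (xbase + idx r p v)"
    have x: "x < n" "cost p x \<le> r" "dist r p v = len p x + dist (r - cost p x) x v"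
      using layers_nextD[OF assms(1) Suc.prems(1-3) False Suc.prems(4)] by (simp_all add: x_def)
    define q where "q = route m v f (r - cost p x) x"
    have "walk (r - cost p x) x v q \<and> walk_len q = dist (r - cost p x) x v"
      unfolding q_def using Suc.prems x by (intro Suc.IH) (auto simp: len_def)
    moreover from this obtain q' where "q = x # q'"
      unfolding walk_def by (metis list.collapse)
    moreover have "route m v (Suc f) r p = p # q"
      using False by (simp add: q_def x_def)
    ultimately show ?thesis
      using x Suc.prems(2) by (simp add: walk_Cons_iff)
  qed
qed

text \<open>The invariant of both traversals: the walker stands at \<open>p\<close> with budget
  \<open>r\<close> left, and \<open>v\<close> is still within reach.\<close>

definition follows :: "nat \<Rightarrow> nat \<Rightarrow> nat \<Rightarrow> nat \<Rightarrow> nat \<Rightarrow> nat \<Rightarrow> state \<Rightarrow> bool" where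
  "follows b k u v r p s \<longleftrightarrow> ctx b k s \<and> layers (ms s) (Suc b) \<and> vs s r_u = u \<and> vs s r_v = v
     \<and> vs s r_rest = r \<and> vs s r_pos = p \<and> v < n \<and> p < n \<and> r \<le> b \<and> b \<le> B \<and> dist r p v < infty"

lemma wp_move:
  assumes s: "follows b k u v r p s" and "p \<noteq> v"
  defines "x \<equiv> ms s (xbase + idx r p v)"
  shows "wp S W move Q s \<longleftrightarrow>
    Q (s\<lparr>vs := (vs s)(r_x := x, r_cost := cost p x, r_rest := r - cost p x, r_pos := x)\<rparr>)"
proof -
  have "x < n"
    using layers_nextD(1)[of "ms s" b r p v] s \<open>p \<noteq> v\<close> unfolding follows_def x_def by blast
  moreover from this have "x < W"
    using num_less_W by simp
  ultimately show ?thesis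
    using s by (simp add: move_def follows_def ctx_def flip: x_def)
qed

lemma follows_move:
  assumes s: "follows b k u v r p s" and "p \<noteq> v"
  defines "x \<equiv> ms s (xbase + idx r p v)"
  shows "follows b k u v (r - cost p x) x
    (s\<lparr>vs := (vs s)(r_x := x, r_cost := cost p x, r_rest := r - cost p x, r_pos := x)\<rparr>)"
proof -
  have "x < n" "dist r p v = len p x + dist (r - cost p x) x v"
    using layers_nextD[of "ms s" b r p v] s \<open>p \<noteq> v\<close> unfolding follows_def x_def by blast+
  moreover have "r - cost p x \<le> b"
    using s by (auto simp: follows_def)
  ultimately show ?thesis
    using s by (simp add: follows_def ctx_def)
qed

lemma csize_move [simp]: "csize move = 67"
  by (simp add: move_def)

lemma neq_loop_test:
  assumes "follows b k u v r p s"
  shows "ok S W (e_diff (Var r_pos) (Var r_v)) s"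
    "ev (Num 0) s < ev (e_diff (Var r_pos) (Var r_v)) s \<longleftrightarrow> p \<noteq> v"
  using assms by (auto simp: follows_def)

text \<open>The bound \<open>n + 1\<close> holds at the start, where \<open>r_len\<close> is 1 and a
  route has at most \<open>n\<close> vertices. It is preserved by each step and keeps the counter
  within a word.\<close>

lemma count_loop:
  assumes "follows b k u v r p s" "dist r p v \<le> f"
    and "vs s r_len + length (route (ms s) v f r p) \<le> n + 1"
  shows "run S W count_loop (length (route (ms s) v f r p) * 300)
    (\<lambda>s'. ctx b k s' \<and> vs s' r_u = u \<and> vs s' r_v = v \<and> ms s' = ms s \<and> os s' = os s
       \<and> vs s' r_len = vs s r_len + length (route (ms s) v f r p) - 1) s"
  using assms
proof (induction f arbitrary: r p s)
  case 0
  have "p = v"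
  proof (rule ccontr)
    assume "p \<noteq> v"
    then show False
      using layers_nextD(3)[of "ms s" b r p v] 0(1,2) by (auto simp: len_def follows_def)
  qed
  with 0 neq_loop_test[OF 0(1)] show ?case
    unfolding count_loop_def
    by (intro run_mono[OF run_While_False]) (auto simp: follows_def)
next
  case (Suc f)
  show ?case
  proof (cases "p = v")
    case True
    with Suc.prems neq_loop_test[OF Suc.prems(1)] show ?thesis
      unfolding count_loop_def
      by (intro run_mono[OF run_While_False]) (auto simp: follows_def)
  next
    case False
    define x where "x = ms s (xbase + idx r p v)"
    define s1 where "s1 = s\<lparr>vs := (vs s)(r_x := x, r_cost := cost p x, r_rest := r - cost p x,
      r_pos := x, r_len := vs s r_len + 1)\<rparr>"
    let ?q = "route (ms s) v f (r - cost p x) x"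
    have route: "route (ms s) v (Suc f) r p = p # ?q"
      using False by (simp add: x_def)
    have len: "vs s r_len + 1 < W"
      using Suc.prems(3) num_less_W(1) length_greater_0_conv[of ?q] unfolding route
      by (simp del: length_greater_0_conv)
    have s1: "follows b k u v (r - cost p x) x s1"
      using follows_move[OF Suc.prems(1) False] by (simp add: follows_def ctx_def s1_def x_def)
    have "dist r p v = len p x + dist (r - cost p x) x v"
      using layers_nextD(3)[of "ms s" b r p v] Suc.prems(1) False unfolding follows_def x_def by blast
    then have "dist (r - cost p x) x v \<le> f"
      using Suc.prems(2) by (simp add: len_def)
    from Suc.IH[OF s1 this]
    have IH: "run S W count_loop (length ?q * 300)
       (\<lambda>s'. ctx b k s' \<and> vs s' r_u = u \<and> vs s' r_v = v \<and> ms s' = ms s \<and> os s' = os s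
         \<and> vs s' r_len = vs s r_len + 1 + length ?q - 1) s1"
      using Suc.prems(3) unfolding route by (simp add: s1_def)
    have "run S W (move ;; Assign r_len (Plus (Var r_len) (Num 1))) 200 (\<lambda>s'. s' = s1) s"
    proof (rule run_wp)
      show "wp S W (move ;; Assign r_len (Plus (Var r_len) (Num 1))) (\<lambda>s'. s' = s1) s"
        using wp_move[OF Suc.prems(1) False] len by (simp add: s1_def x_def)
    qed simp
    then show ?thesis
      unfolding count_loop_def
    proof (rule run_While_True[rotated 3])
      show "run S W (While (Num 0) (e_diff (Var r_pos) (Var r_v)) (move ;; Assign r_len (Plus (Var r_len) (Num 1))))
        (length ?q * 300) (\<lambda>s'. ctx b k s' \<and> vs s' r_u = u \<and> vs s' r_v = v \<and> ms s' = ms s \<and> os s' = os s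
         \<and> vs s' r_len = vs s r_len + length (route (ms s) v (Suc f) r p) - 1) s'" if "s' = s1" for s'
        using IH unfolding that route count_loop_def by simp
      show "ok S W (e_diff (Var r_pos) (Var r_v)) s"
        "ev (Num 0) s < ev (e_diff (Var r_pos) (Var r_v)) s"
        using neq_loop_test[OF Suc.prems(1)] False by blast+
    qed (simp_all add: route del: route.simps)
  qed
qed

text \<open>The loop stops on reaching \<open>v\<close> without writing it, hence the equation with
  \<open>v\<close> appended on the left; \<open>v\<close> is written by the command after the
  loop.\<close>

lemma write_loop:
  assumes "follows b k u v r p s" "dist r p v \<le> f"
  shows "run S W write_loop (length (route (ms s) v f r p) * 300)
    (\<lambda>s'. ctx b k s' \<and> vs s' r_u = u \<and> vs s' r_v = v \<and> ms s' = ms s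
       \<and> os s' @ [v] = os s @ route (ms s) v f r p) s"
  using assms
proof (induction f arbitrary: r p s)
  case 0
  have "p = v"
  proof (rule ccontr)
    assume "p \<noteq> v"
    then show False
      using layers_nextD(3)[of "ms s" b r p v] 0(1,2) by (auto simp: len_def follows_def)
  qed
  with 0 neq_loop_test[OF 0(1)] show ?case
    unfolding write_loop_def
    by (intro run_mono[OF run_While_False]) (auto simp: follows_def)
next
  case (Suc f)
  show ?case
  proof (cases "p = v")
    case True
    with Suc.prems neq_loop_test[OF Suc.prems(1)] show ?thesis
      unfolding write_loop_def
      by (intro run_mono[OF run_While_False]) (auto simp: follows_def)
  next
    case False
    define x where "x = ms s (xbase + idx r p v)"
    define s1 where "s1 = s\<lparr>os := os s @ [p], vs := (vs s)(r_x := x, r_cost := cost p x,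
      r_rest := r - cost p x, r_pos := x)\<rparr>"
    let ?q = "route (ms s) v f (r - cost p x) x"
    have route: "route (ms s) v (Suc f) r p = p # ?q"
      using False by (simp add: x_def)
    have s0: "follows b k u v r p (s\<lparr>os := os s @ [p]\<rparr>)"
      using Suc.prems(1) by (simp add: follows_def ctx_def)
    have s1: "follows b k u v (r - cost p x) x s1"
      using follows_move[OF s0 False] by (simp add: s1_def x_def)
    have "dist r p v = len p x + dist (r - cost p x) x v"
      using layers_nextD(3)[of "ms s" b r p v] Suc.prems(1) False unfolding follows_def x_def by blast
    then have "dist (r - cost p x) x v \<le> f"
      using Suc.prems(2) by (simp add: len_def)
    from Suc.IH[OF s1 this]
    have IH: "run S W write_loop (length ?q * 300)
       (\<lambda>s'. ctx b k s' \<and> vs s' r_u = u \<and> vs s' r_v = v \<and> ms s' = ms s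
         \<and> os s' @ [v] = os s @ p # ?q) s1"
      by (simp add: s1_def)
    have "run S W (Out (Var r_pos) ;; move) 200 (\<lambda>s'. s' = s1) s"
    proof (rule run_wp)
      show "wp S W (Out (Var r_pos) ;; move) (\<lambda>s'. s' = s1) s"
        using wp_move[OF s0 False] Suc.prems(1) by (simp add: s1_def x_def follows_def)
    qed simp
    then show ?thesis
      unfolding write_loop_def
    proof (rule run_While_True[rotated 3])
      show "run S W (While (Num 0) (e_diff (Var r_pos) (Var r_v)) (Out (Var r_pos) ;; move))
        (length ?q * 300) (\<lambda>s'. ctx b k s' \<and> vs s' r_u = u \<and> vs s' r_v = v \<and> ms s' = ms s
         \<and> os s' @ [v] = os s @ route (ms s) v (Suc f) r p) s'" if "s' = s1" for s'
        using IH unfolding that route write_loop_def by simp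
      show "ok S W (e_diff (Var r_pos) (Var r_v)) s"
        "ev (Num 0) s < ev (e_diff (Var r_pos) (Var r_v)) s"
        using neq_loop_test[OF Suc.prems(1)] False by blast+
    qed (simp_all add: route del: route.simps)
  qed
qed

definition answer :: "nat \<Rightarrow> nat \<Rightarrow> nat \<Rightarrow> nat list \<Rightarrow> bool" where
  "answer b u v ys \<longleftrightarrow> (\<exists>p. ys = length p # p
     \<and> (if dist b u v < infty then walk b u v p \<and> walk_len p = dist b u v else p = []))"

lemma print_cell:
  assumes s: "ctx b k s" "layers (ms s) (Suc b)" "vs s r_u = u" "vs s r_v = v"
    and b: "b \<le> B" and uv: "u < n" "v < n"
  shows "run S W
     (If (Ld (a_dist (Var r_b) (Var r_u) (Var r_v))) (Var r_infty)
       ((start ;; Assign r_len (Num 1)) ;; count_loop ;; (Out (Var r_len) ;; start)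
        ;; write_loop ;; Out (Var r_v))
       (Out (Num 0))) (n * 600 + 300)
     (\<lambda>s'. ctx b k s' \<and> vs s' r_u = u \<and> vs s' r_v = v \<and> ms s' = ms s
        \<and> (\<exists>ys. answer b u v ys \<and> os s' = os s @ ys)) s"
  (is "run _ _ _ _ ?Q _")
proof -
  define d where "d = dist b u v"
  define p where "p = route (ms s) v d b u"
  have d: "ms s (dbase + idx b u v) = d"
    using layersD[OF s(2), of b u v] uv by (simp add: d_def)
  have start: "wp S W start (\<lambda>s'. s' = s0\<lparr>vs := (vs s0)(r_pos := u, r_rest := b)\<rparr>) s0"
    if "ctx b k s0" "vs s0 r_u = u" for s0
    using that by (simp add: start_def ctx_def)
  show ?thesis
  proof (rule run_mono[OF run_If[where T = "n * 600 + 200"]])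
    show "ok S W (Ld (a_dist (Var r_b) (Var r_u) (Var r_v))) s"
      using s b uv d sum_less_W(2)[OF dist_le_infty[of b u v]] by (simp add: ctx_def d_def)
    assume "ev (Ld (a_dist (Var r_b) (Var r_u) (Var r_v))) s < ev (Var r_infty) s"
    then have fin: "dist b u v < infty"
      using s uv b d frameD(4)[of "vs s" "ms s"] by (simp add: ctx_def d_def)
    have p: "walk b u v p" "walk_len p = dist b u v"
      using route_shortest[OF s(2), of b u v d] uv fin by (simp_all add: p_def d_def)
    \<comment> \<open>The route is a shortest walk, hence simple. This bounds each of the two
      traversals by \<open>300 * n\<close> steps.\<close>
    have len: "length p \<le> n" "p \<noteq> []"
      using distinct_length_le shortest_walk_distinct[OF p] p unfolding walk_def by blast+
    then have len': "0 < length p" "length p < W" "length p * 300 \<le> n * 300"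
      using num_less_W by auto
    let ?R1 = "\<lambda>s'. follows b k u v b u s' \<and> ms s' = ms s \<and> os s' = os s \<and> vs s' r_len = 1"
    let ?R2 = "\<lambda>s'. ctx b k s' \<and> vs s' r_u = u \<and> vs s' r_v = v \<and> ms s' = ms s \<and> os s' = os s
       \<and> vs s' r_len = length p"
    let ?R3 = "\<lambda>s'. follows b k u v b u s' \<and> ms s' = ms s \<and> os s' = os s @ [length p]"
    let ?R4 = "\<lambda>s'. ctx b k s' \<and> vs s' r_u = u \<and> vs s' r_v = v \<and> ms s' = ms s
       \<and> os s' @ [v] = os s @ length p # p"
    show "run S W ((start ;; Assign r_len (Num 1)) ;; count_loop ;; (Out (Var r_len) ;; start)
        ;; write_loop ;; Out (Var r_v)) (n * 600 + 200) ?Q s"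
    proof (rule run_Seq[where R = ?R1 and ?T1.0 = 50 and ?T2.0 = "n * 600 + 150"], goal_cases)
      case 1
      show ?case
        by (rule run_wp) (use s uv b fin in \<open>simp_all add: start_def ctx_def follows_def\<close>)
    next
      case (2 s1)
      then have s1: "follows b k u v b u s1" "ms s1 = ms s" "os s1 = os s" "vs s1 r_len = 1"
        by auto
      show ?case
      proof (rule run_Seq[where R = ?R2 and ?T1.0 = "n * 300" and ?T2.0 = "n * 300 + 150"], goal_cases)
        case 1
        show ?case
          by (rule run_mono[OF count_loop[OF s1(1), of d]])
            (use s1 len len' in \<open>auto simp: d_def p_def\<close>)
      next
        case (2 s2)
        show ?case
        proof (rule run_Seq[where R = ?R3 and ?T1.0 = 50 and ?T2.0 = "n * 300 + 100"], goal_cases)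
          case 1
          show ?case
            by (rule run_wp) (use s(2) 2 uv b fin in \<open>auto simp: start_def ctx_def follows_def\<close>)
        next
          case (2 s3)
          then have s3: "follows b k u v b u s3" "ms s3 = ms s" "os s3 = os s @ [length p]"
            by auto
          show ?case
          proof (rule run_Seq[where R = ?R4 and ?T1.0 = "n * 300" and ?T2.0 = 100], goal_cases)
            case 1
            show ?case
              by (rule run_mono[OF write_loop[OF s3(1), of d]])
                (use s3 len len' in \<open>auto simp: d_def p_def\<close>)
          next
            case (2 s4)
            have "answer b u v (length p # p)"
              using p fin by (auto simp: answer_def)
            with 2 show ?case
              by (intro run_wp) (auto simp: ctx_def)
          qed simp
        qed simp
      qed simp
    qed simp
  next
    assume "\<not> ev (Ld (a_dist (Var r_b) (Var r_u) (Var r_v))) s < ev (Var r_infty) s"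
    then have "\<not> dist b u v < infty"
      using s uv b d frameD(4)[of "vs s" "ms s"] by (simp add: ctx_def d_def)
    then have "answer b u v [0]"
      by (auto simp: answer_def)
    then show "run S W (Out (Num 0)) (n * 600 + 200) ?Q s"
      by (intro run_wp) (use s in \<open>auto simp: ctx_def\<close>)
  qed simp_all
qed

text \<open>In the invariant \<open>ys\<close> holds the finished rows and \<open>ys'\<close> the
  cells of the current row; at the end of a row \<open>ys'\<close> becomes one further block of
  \<open>ys\<close>.\<close>

lemma print_phase:
  assumes s: "ctx b k s" "layers (ms s) (Suc b)" and b: "b \<le> B"
  shows "run S W print_phase (n * (n * (n * 600 + 340) + 40))
    (\<lambda>s'. ctx b k s' \<and> layers (ms s') (Suc b)
       \<and> (\<exists>ys. seqs (\<lambda>u. seqs (answer b u) n) n ys \<and> os s' = os s @ ys)) s"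
  unfolding print_phase_def
proof (rule run_mono[OF run_cells[where b = b and k = k and s = s and T = "n * 600 + 300" and P = "\<lambda>u v m zs. layers m (Suc b) \<and>
      (\<exists>ys ys'. zs = os s @ ys @ ys' \<and> seqs (\<lambda>u. seqs (answer b u) n) u ys \<and> seqs (answer b u) v ys')"]],
    goal_cases)
  case 1
  then show ?case using s by simp
next
  case 2
  then show ?case using s by simp
next
  case (3 u v s0)
  then obtain ys ys' where ys: "os s0 = os s @ ys @ ys'" "seqs (\<lambda>u. seqs (answer b u) n) u ys"
    "seqs (answer b u) v ys'"
    by blast
  show ?case
  proof (rule run_mono[OF print_cell[of b k s0 u v] order_refl])
    fix s1
    assume s1: "ctx b k s1 \<and> vs s1 r_u = u \<and> vs s1 r_v = v \<and> ms s1 = ms s0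
        \<and> (\<exists>zs. answer b u v zs \<and> os s1 = os s0 @ zs)"
    then obtain zs where zs: "answer b u v zs" "os s1 = os s @ ys @ (ys' @ zs)"
      using ys by auto
    show "ctx b k s1 \<and> vs s1 r_u = u \<and> vs s1 r_v = v \<and> layers (ms s1) (Suc b) \<and>
      (\<exists>ys ys'. os s1 = os s @ ys @ ys' \<and> seqs (\<lambda>u. seqs (answer b u) n) u ys \<and> seqs (answer b u) (Suc v) ys')"
      using s1 zs ys 3 seqs_Suc[OF ys(3) zs(1)] by auto
  qed (use 3 b in auto)
next
  case (4 u m zs)
  then obtain ys ys' where ys: "zs = os s @ ys @ ys'" "seqs (\<lambda>u. seqs (answer b u) n) u ys"
    "seqs (answer b u) n ys'"
    by blast
  from 4 ys(1) seqs_Suc[OF ys(2,3)] show ?case by auto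
qed auto

end


section \<open>The complete program\<close>

lemma concat_concat: "concat (concat xss) = concat (map concat xss)"
  by (induction xss) auto

context apbsp_ram
begin

definition layer_time :: nat where
  "layer_time = n * (n * (n * 2040 + 4040) + 40) + (n * (n * (n * 1040 + 40) + 40)
     + (n * (n * (n * 2040 + 2040) + 40) + n * (n * (n * 600 + 340) + 40)))"

definition layer_answer :: "nat \<Rightarrow> nat list \<Rightarrow> bool" where
  "layer_answer b = seqs (\<lambda>u. seqs (answer b u) n) n"

lemma layer:
  assumes s: "frame (vs s) (ms s)" "layers (ms s) b" "vs s r_b = b" and b: "b \<le> B"
  shows "run S W (init_phase ;; close_phase ;; next_phase ;; print_phase) layer_time
    (\<lambda>s'. frame (vs s') (ms s') \<and> layers (ms s') (Suc b) \<and> vs s' r_b = b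
       \<and> (\<exists>ys. layer_answer b ys \<and> os s' = os s @ ys)) s"
  unfolding layer_time_def
proof (rule run_Seq'[OF init_phase[of b "vs s r_k"]], goal_cases)
  case 1
  show ?case using s by (simp add: ctx_def)
next
  case 2
  show ?case by (rule b)
next
  case (3 s1)
  show ?case
  proof (rule run_Seq'[OF close_phase[of b "vs s r_k"]], goal_cases)
    case (4 s2)
    show ?case
    \<comment> \<open>The closing loop leaves its counter at \<open>n\<close>, which is the second
      parameter of \<open>ctx\<close> from here on.\<close>
    proof (rule run_Seq'[OF next_phase[of b n]], goal_cases)
      case (4 s3)
      show ?case
        by (rule run_mono[OF print_phase[of b n]])
          (use 3 4 \<open>ctx b n s2 \<and> os s2 = os s1 \<and> _\<close> b in \<open>auto simp: ctx_def layer_answer_def\<close>)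
    qed (use 4 b in auto)
  qed (use 3 b in auto)
qed

lemma fold_max_take_Suc:
  "x < length xs \<Longrightarrow> fold max (take (Suc x) xs) a = max (xs ! x) (fold max (take x xs) (a :: nat))"
  by (simp add: take_Suc_conv_app_nth)

definition start_state :: state where
  "start_state = \<lparr>vs = (\<lambda>_. 0), ms = (\<lambda>i. if i < length inp then inp ! i else 0), os = []\<rparr>"

lemma setup1:
  "run S W setup1 100 (\<lambda>s. frame ((vs s)(r_infty := infty)) (ms s) \<and> os s = [] \<and> vs s r_acc = 0)
     start_state"
proof (rule run_wp)
  have nn: "1 \<le> n * n" "Suc B * (n * n) \<ge> 1 * (n * n)"
    using n by (simp_all del: mult_Suc)
  then have "3 * (n * n) < W" "dbase < W" "Suc B * (n * n) < W" "xbase < W" "1 < dbase" "dbase < S"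
    using S_le_W unfolding S_def xbase_def dbase_def by linarith+
  then show "wp S W setup1
      (\<lambda>s. frame ((vs s)(r_infty := infty)) (ms s) \<and> os s = [] \<and> vs s r_acc = 0) start_state"
    using num_less_W inp_0 inp_1
    by (simp add: setup1_def start_state_def frame_def length_inp dbase_def xbase_def del: mult_Suc)
qed (simp add: setup1_def)

text \<open>Before \<open>setup2\<close>, the frame holds except for the register that will hold \<open>infty\<close>.\<close>

lemma frame_upd_var_infty:
  "8 \<le> x \<Longrightarrow> frame (f(x := y, r_infty := z)) m \<longleftrightarrow> frame (f(r_infty := z)) m"
  by (subst fun_upd_twist) simp_all

lemma max_loop:
  assumes s: "frame ((vs s)(r_infty := infty)) (ms s)" "os s = []" "vs s r_acc = 0"
  shows "run S W (For r_x r_nn max_step) (n * n * 140)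
     (\<lambda>s. frame ((vs s)(r_infty := infty)) (ms s) \<and> os s = [] \<and> vs s r_acc = wmax) s"
proof (rule run_mono[OF run_For'[where T = 100 and N = "n * n"
    and I = "\<lambda>x s. frame ((vs s)(r_infty := infty)) (ms s) \<and> os s = []
      \<and> vs s r_x = x \<and> vs s r_acc = fold max (take x (matrix n (K_weight w))) 0"
    and Q = "\<lambda>s. frame ((vs s)(r_infty := infty)) (ms s) \<and> os s = [] \<and> vs s r_acc = wmax"]], goal_cases)
  case 1
  then show ?case using s by (simp add: frame_upd_var_infty)
next
  case (2 i s)
  then show ?case by (simp add: frame_def)
next
  case (3 x s)
  let ?y = "matrix n (K_weight w) ! x"
  have a: "2 + n * n + x < dbase"
    using 3 by (simp add: dbase_def)
  then have a': "2 + n * n + x < S"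
    by (simp add: S_def xbase_def)
  have y: "ms s (2 + n * n + x) = ?y"
    using 3 a inp_weight'[of x] by (simp add: frame_def)
  have "inp ! (2 + n * n + x) \<in> set inp"
    using a by (intro nth_mem) (simp add: length_inp)
  then have "?y < W"
    using inp_less_W inp_weight'[of x] 3 by simp
  then show ?case
    using 3 y a' S_le_W num_less_W fold_max_take_Suc[of x "matrix n (K_weight w)" 0]
    by (intro run_wp) (auto simp: max_step_def frame_upd_var_infty frame_def max_def)
qed (use n num_less_W in \<open>auto simp: wmax_def\<close>)

lemma setup2:
  assumes s: "frame ((vs s)(r_infty := infty)) (ms s)" "os s = []" "vs s r_acc = wmax"
  shows "run S W setup2 100 (\<lambda>s. frame (vs s) (ms s) \<and> os s = []) s"
proof (rule run_wp)
  have "vs s r_n = n"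
    using s by (simp add: frame_def)
  then have "ev (Plus (Times (Var r_n) (Plus (Times (Var r_n) (Var r_acc)) (Num 1))) (Num 1)) s = infty"
    using s by (simp add: infty_def)
  moreover have "ok S W (Plus (Times (Var r_n) (Plus (Times (Var r_n) (Var r_acc)) (Num 1))) (Num 1)) s"
    using s \<open>vs s r_n = n\<close> wmax_less_W infty_less_W by (simp add: infty_def)
  ultimately show "wp S W setup2 (\<lambda>s. frame (vs s) (ms s) \<and> os s = []) s"
    using s by (simp add: setup2_def)
qed (simp add: setup2_def)

lemma main:
  "run S W main (200 + n * n * 140 + Suc B * (layer_time + 40))
     (\<lambda>s. seqs layer_answer (Suc B) (os s)) start_state"
proof -
  have loop: "run S W (For r_b r_B (init_phase ;; close_phase ;; next_phase ;; print_phase))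
      (Suc B * (layer_time + 40)) (\<lambda>s. seqs layer_answer (Suc B) (os s)) s"
    if s: "frame (vs s) (ms s) \<and> os s = []" for s
  proof (rule run_For'[where I = "\<lambda>b (s :: state). frame (vs s) (ms s) \<and> layers (ms s) b \<and> vs s r_b = b
      \<and> seqs layer_answer b (os s)"])
    fix b and s :: state
    assume s: "frame (vs s) (ms s) \<and> layers (ms s) b \<and> vs s r_b = b \<and> seqs layer_answer b (os s)"
      and b: "b < Suc B"
    show "run S W (init_phase ;; close_phase ;; next_phase ;; print_phase) layer_time
      (\<lambda>s'. vs s' r_b = b \<and> frame (vs (s'\<lparr>vs := (vs s')(r_b := Suc b)\<rparr>)) (ms (s'\<lparr>vs := (vs s')(r_b := Suc b)\<rparr>))
        \<and> layers (ms (s'\<lparr>vs := (vs s')(r_b := Suc b)\<rparr>)) (Suc b)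
        \<and> vs (s'\<lparr>vs := (vs s')(r_b := Suc b)\<rparr>) r_b = Suc b
        \<and> seqs layer_answer (Suc b) (os (s'\<lparr>vs := (vs s')(r_b := Suc b)\<rparr>))) s"
      by (rule run_mono[OF layer[of s b]]) (use s b seqs_Suc in auto)
  qed (use that num_less_W in \<open>auto simp: frame_def layers_def\<close>)
  show ?thesis
    unfolding main_def
  proof (rule run_Seq[OF setup1, where ?T2.0 = "n * n * 140 + (100 + Suc B * (layer_time + 40))"], goal_cases)
    case (1 s1)
    show ?case
    proof (rule run_Seq'[OF max_loop], goal_cases)
      case (4 s2)
      show ?case
        by (rule run_Seq'[OF setup2 loop]) (use 4 in auto)
    qed (use 1 in auto)
  qed simp
qed

section \<open>Bounds on time and space\<close>

lemma layer_time_le: "layer_time \<le> 12400 * n ^ 3"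
proof -
  have "n * n * 1 \<le> n * n * n" "n * 1 \<le> n * n"
    using n by (intro mult_le_mono; simp)+
  then have "n * n \<le> n ^ 3" "n \<le> n ^ 3"
    by (simp_all add: power3_eq_cube)
  moreover have "layer_time = 5720 * n ^ 3 + 6460 * (n * n) + 160 * n"
    by (simp add: layer_time_def power3_eq_cube algebra_simps)
  ultimately show ?thesis by linarith
qed

text \<open>Even \<open>B = 0\<close> requires one layer, hence \<open>max 1 B\<close>. From
  \<open>Suc B \<le> 2 * max 1 B\<close> the layers take at most 24880 units of
  \<open>max 1 B * n ^ 3\<close>, and the setup adds at most 340.\<close>

lemma main_time_le: "200 + n * n * 140 + Suc B * (layer_time + 40) \<le> 30000 * (max 1 B * n ^ 3)"
proof -
  have "n * n * 1 \<le> n * n * n" "1 * 1 * 1 \<le> n * n * n"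
    using n by (intro mult_le_mono; simp)+
  then have n3: "n * n \<le> n ^ 3" "1 \<le> n ^ 3"
    by (simp_all add: power3_eq_cube)
  have b: "1 * n ^ 3 \<le> max 1 B * n ^ 3"
    by (intro mult_le_mono) auto
  have "Suc B * (layer_time + 40) \<le> (2 * max 1 B) * (12440 * n ^ 3)"
    using layer_time_le n3 by (intro mult_le_mono) auto
  also have "\<dots> = 24880 * (max 1 B * n ^ 3)"
    by simp
  finally show ?thesis
    using n3 b by linarith
qed

text \<open>The constant is 2 for the header, 3 for the input matrices and 4 for two tables of at
  most \<open>2 * max 1 B\<close> layers.\<close>

lemma S_bound: "S \<le> 9 * (max 1 B * n ^ 2)"
proof -
  have "1 * 1 \<le> n * n"
    using n by (intro mult_le_mono) auto
  moreover have "1 * (n * n) \<le> max 1 B * (n * n)" "Suc B * (n * n) \<le> (2 * max 1 B) * (n * n)"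
    by (intro mult_le_mono; simp)+
  ultimately show ?thesis
    unfolding S_def xbase_def dbase_def power2_eq_square by linarith
qed

text \<open>The nested blocks are unfolded level by level, choosing \<open>g\<close>,
  \<open>h\<close>, \<open>k\<close> and finally the paths \<open>P\<close>. The range conditions
  sit inside the existential quantifiers, so that each choice function is total.\<close>

lemma answers_imp_output:
  assumes "seqs layer_answer (Suc B) ys"
  shows "apbsp_output n E w c B ys"
proof -
  obtain g where g: "\<forall>\<beta><Suc B. layer_answer \<beta> (g \<beta>)" "ys = concat (map g [0..<Suc B])"
    using assms by (auto simp: seqs_def)
  have "\<forall>\<beta>. \<exists>h. \<beta> < Suc B \<longrightarrow> (\<forall>u<n. seqs (answer \<beta> u) n (h u)) \<and> g \<beta> = concat (map h [0..<n])"
    using g(1) by (auto simp: layer_answer_def seqs_def)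
  then obtain h where h: "\<And>\<beta>. \<beta> < Suc B \<Longrightarrow> (\<forall>u<n. seqs (answer \<beta> u) n (h \<beta> u)) \<and> g \<beta> = concat (map (h \<beta>) [0..<n])"
    by metis
  have "\<forall>\<beta> u. \<exists>k. \<beta> < Suc B \<and> u < n \<longrightarrow> (\<forall>v<n. answer \<beta> u v (k v)) \<and> h \<beta> u = concat (map k [0..<n])"
    using h by (auto simp: seqs_def)
  then obtain k where k: "\<And>\<beta> u. \<beta> < Suc B \<Longrightarrow> u < n \<Longrightarrow>
      (\<forall>v<n. answer \<beta> u v (k \<beta> u v)) \<and> h \<beta> u = concat (map (k \<beta> u) [0..<n])"
    by metis
  have "\<forall>\<beta> u v. \<exists>p. \<beta> < Suc B \<and> u < n \<and> v < n \<longrightarrow> k \<beta> u v = length p # p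
     \<and> (if dist \<beta> u v < infty then walk \<beta> u v p \<and> walk_len p = dist \<beta> u v else p = [])"
    using k unfolding answer_def by blast
  then obtain P where P: "\<And>\<beta> u v. \<beta> < Suc B \<Longrightarrow> u < n \<Longrightarrow> v < n \<Longrightarrow> k \<beta> u v = length (P \<beta> u v) # P \<beta> u v
     \<and> (if dist \<beta> u v < infty then walk \<beta> u v (P \<beta> u v) \<and> walk_len (P \<beta> u v) = dist \<beta> u v
        else P \<beta> u v = [])"
    by metis
  have "ys = concat (map (\<lambda>\<beta>. concat (map (\<lambda>u. concat (map (\<lambda>v. length (P \<beta> u v) # P \<beta> u v) [0..<n]))
      [0..<n])) [0..<Suc B])"
    unfolding g(2) using h k P
    by (intro arg_cong[of _ _ concat] map_cong refl) (auto intro!: arg_cong[of _ _ concat] map_cong)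
  also have "\<dots> = concat [length (P \<beta> u v) # P \<beta> u v. \<beta> \<leftarrow> [0..<Suc B], u \<leftarrow> [0..<n], v \<leftarrow> [0..<n]]"
    by (simp add: concat_concat map_concat comp_def)
  finally have "ys = concat [length (P \<beta> u v) # P \<beta> u v. \<beta> \<leftarrow> [0..<Suc B], u \<leftarrow> [0..<n], v \<leftarrow> [0..<n]]" .
  moreover have "if \<exists>p. bounded_cost_path {..<n} E c \<beta> u v p
             then min_weight_path {..<n} E w c \<beta> u v (P \<beta> u v) else P \<beta> u v = []"
    if "\<beta> \<le> B" "u < n" "v < n" for \<beta> u v
    using P[of \<beta> u v] that shortest_walk_min_weight_path unfolding ex_bounded_cost_path_iff
    by (auto split: if_splits)
  ultimately show ?thesis
    unfolding apbsp_output_def by blast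
qed

lemma main_computes:
  "\<exists>t ys. ram_computes S W (compile 0 main) inp t ys \<and> apbsp_output n E w c B ys
     \<and> t \<le> 30000 * (max 1 B * n ^ 3)"
proof -
  have "represents W start_state (init_config inp)"
    by (simp add: represents_def start_state_def init_config_def)
  moreover have "pc (init_config inp) = length ([] :: instr list)"
    by (simp add: init_config_def)
  ultimately obtain t q s where
    "t \<le> 200 + n * n * 140 + Suc B * (layer_time + 40)"
    "exec_steps S W ([] @ compile (length ([] :: instr list)) main @ []) t (init_config inp) = Some q"
    "pc q = length ([] :: instr list) + csize main" "represents W s q" "seqs layer_answer (Suc B) (os s)"
    using main unfolding run_def by blast
  then have "ram_computes S W (compile 0 main) inp t (os s) \<and> apbsp_output n E w c B (os s)
      \<and> t \<le> 30000 * (max 1 B * n ^ 3)"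
    using answers_imp_output main_time_le inp_less_W
    by (auto simp: ram_computes_def represents_def length_inp S_def xbase_def)
  then show ?thesis by blast
qed

end

theorem theorem1:
  "\<exists>(prog :: instr list) (k :: nat) (C :: real).
     \<forall>(n :: nat) (E :: nat set set) (w :: nat set \<Rightarrow> nat) (c :: nat set \<Rightarrow> nat) (B :: nat).
       n \<ge> 1 \<longrightarrow> E \<subseteq> pairs {..<n} \<longrightarrow> (\<forall>e\<in>pairs {..<n}. c e \<ge> 1) \<longrightarrow>
       (\<exists>S t ys.
          ram_computes S (word_bound k (apbsp_input n E w c B)) prog (apbsp_input n E w c B) t ys
        \<and> apbsp_output n E w c B ys
        \<and> (let b = real (max 1 B) in
             real t \<le> C * (b * real n ^ 3 + b * real n ^ 2 * log 2 (b * real n))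
           \<and> real S \<le> C * (b * real n ^ 2)))"
\<comment> \<open>The exponent 8 is the one for which all word bounds were checked, and 30000 covers
  both the time bound and the space bound.\<close>
proof (rule exI[of _ "compile 0 main"], rule exI[of _ 8], rule exI[of _ 30000], intro allI impI)
  fix n B :: nat and E :: "nat set set" and w c :: "nat set \<Rightarrow> nat"
  assume "n \<ge> 1" "E \<subseteq> pairs {..<n}" "\<forall>e\<in>pairs {..<n}. c e \<ge> 1"
  then interpret apbsp_ram n E w c B
    by unfold_locales auto
  obtain t ys where t: "ram_computes S W (compile 0 main) inp t ys" "apbsp_output n E w c B ys"
    "t \<le> 30000 * (max 1 B * n ^ 3)"
    using main_computes by blast
  define b where "b = real (max 1 B)"
  \<comment> \<open>The argument of the logarithm is at least 1, so the second summand is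
    nonnegative and the cubic bound on \<open>t\<close> carries over to the sum.\<close>
  have "1 * 1 \<le> b * real n"
    using \<open>n \<ge> 1\<close> unfolding b_def by (intro mult_mono) auto
  then have "0 \<le> b * real n ^ 2 * log 2 (b * real n)"
    by (intro mult_nonneg_nonneg zero_le_log_cancel_iff[THEN iffD2]) (auto simp: b_def)
  moreover have "real t \<le> 30000 * (b * real n ^ 3)"
    using t(3) unfolding b_def by (metis of_nat_le_iff of_nat_mult of_nat_numeral of_nat_power)
  ultimately have "real t \<le> 30000 * (b * real n ^ 3 + b * real n ^ 2 * log 2 (b * real n))"
    by simp
  moreover have "real S \<le> 9 * (b * real n ^ 2)"
    using S_bound unfolding b_def by (metis of_nat_le_iff of_nat_mult of_nat_numeral of_nat_power)
  then have "real S \<le> 30000 * (b * real n ^ 2)"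
    using \<open>1 * 1 \<le> b * real n\<close> zero_le_mult_iff[of b "real n ^ 2"] by (simp add: b_def)
  ultimately show "\<exists>S t ys.
          ram_computes S (word_bound 8 (apbsp_input n E w c B)) (compile 0 main) (apbsp_input n E w c B) t ys
        \<and> apbsp_output n E w c B ys
        \<and> (let b = real (max 1 B) in
             real t \<le> 30000 * (b * real n ^ 3 + b * real n ^ 2 * log 2 (b * real n))
           \<and> real S \<le> 30000 * (b * real n ^ 2))"
    using t unfolding Let_def b_def[symmetric] W_def inp_def by blast
qed

end
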